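(* For all integers $m\ge1$ and $n\ge0$, $$\mathrm{M}(C_{m,n})=\sqrt[4]{\prod_{k=1}^{n}\Big[1+\Big(\cos\tfrac{k\pi}{n+1}+\sqrt{1+\cos^2\tfrac{k\pi}{n+1}}\Big)^{m}\Big]\Big[1+\Big(\cos\tfrac{k\pi}{n+1}-\sqrt{1+\cos^2\tfrac{k\pi}{n+1}}\Big)^{m}\Big]}$$ $$\times\sqrt[4]{\prod_{k=1}^{n}\Big[1+\Big(-\cos\tfrac{k\pi}{n+1}+\sqrt{1+\cos^2\tfrac{k\pi}{n+1}}\Big)^{m}\Big]\Big[1+\Big(-\cos\tfrac{k\pi}{n+1}-\sqrt{1+\cos^2\tfrac{k\pi}{n+1}}\Big)^{m}\Big]}.$$
   Context: The square cylinder graph $C_{m,n}$ is obtained from the $m\times n$ grid graph with vertex set $\{(i,j)\in\mathbb Z^2: 0\le i\le m-1,\ 0\le j\le n-1\}$ (vertices adjacent when at distance $1$) by adding, for each $j=0,\dots,n-1$, an edge joining $(0,j)$ to $(m-1,j)$; for $m=1$ these are loops (irrelevant for perfect matchings) and for $m=2$ they are parallel to existing edges (multigraph). For $n=0$ it is the empty graph. $\mathrm{M}(G)$ is the number of perfect matchings of $G$.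
   Formalization: When m is odd and n ≡ 2 mod 4, both products under the fourth roots are negative (for m=1, n=2 each is −1), so the real roots are undefined; the product of the two fourth roots is read as the nonnegative fourth root of the combined product. *)

theory Defs
  imports "HOL-Analysis.Product_Vector"
begin

text \<open>Undirected multigraphs: edges are labels, so that parallel edges stay distinct; \<open>ends e\<close> is
  the set of endpoints of \<open>e\<close>, a singleton exactly when \<open>e\<close> is a loop.\<close>

record ('v, 'e) multigraph =
  verts :: "'v set"
  edges :: "'e set"
  ends :: "'e \<Rightarrow> 'v set"

text \<open>Loops never belong to a matching.\<close>

definition perfect_matching :: "('v, 'e) multigraph \<Rightarrow> 'e set \<Rightarrow> bool" where
  "perfect_matching G M \<longleftrightarrow>
     M \<subseteq> edges G \<and>
     (\<forall>e\<in>M. card (ends G e) = 2) \<and>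
     (\<forall>v\<in>verts G. \<exists>!e. e \<in> M \<and> v \<in> ends G e)"

definition num_perfect_matchings :: "('v, 'e) multigraph \<Rightarrow> nat" where
  "num_perfect_matchings G = card {M. perfect_matching G M}"

definition grid_verts :: "nat \<Rightarrow> nat \<Rightarrow> (int \<times> int) set" where
  "grid_verts m n = {0..int m - 1} \<times> {0..int n - 1}"

text \<open>Here \<open>dist\<close> is the Euclidean distance on pairs of integers.\<close>

definition grid_edges :: "nat \<Rightarrow> nat \<Rightarrow> (int \<times> int) set set" where
  "grid_edges m n = {{u, v} | u v. u \<in> grid_verts m n \<and> v \<in> grid_verts m n \<and> dist u v = 1}"

text \<open>\<open>Wrap j\<close> is the added edge joining \<open>(0, j)\<close> to \<open>(m - 1, j)\<close>. For \<open>m = 1\<close> it is a loop; for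
  \<open>m = 2\<close> it is parallel to, but distinct from, the grid edge with the same endpoints.\<close>

datatype cylinder_edge = Grid "(int \<times> int) set" | Wrap int

definition cylinder_graph :: "nat \<Rightarrow> nat \<Rightarrow> (int \<times> int, cylinder_edge) multigraph" where
  "cylinder_graph m n =
     \<lparr>verts = grid_verts m n,
      edges = Grid ` grid_edges m n \<union> Wrap ` {0..int n - 1},
      ends = (\<lambda>e. case e of Grid s \<Rightarrow> s | Wrap j \<Rightarrow> {(0, j), (int m - 1, j)})\<rparr>"

text \<open>For odd \<open>m\<close> and \<open>n\<close> congruent to 2 modulo 4, each of the two products in the formula for the
  number of perfect matchings is negative, while the product of the two is always nonnegative
  (they are equal, by \<open>k \<mapsto> n + 1 - k\<close>). The product of their fourth roots means the nonnegative
  fourth root of the combined product. It can be written as a product of two values of \<^term>\<open>root 4\<close>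
  because \<^term>\<open>root 4\<close> is odd and hence multiplicative on all reals (\<open>real_root_mult\<close>).\<close>

end

theory Submission
  imports Defs "HOL-Library.Function_Algebras" "Jordan_Normal_Form.Determinant"
begin

text \<open>Cut the cylinder into its \<open>m\<close> columns of \<open>n\<close> vertices. The set \<open>S\<close> of horizontal edges entering a column and
  a set \<open>D\<close> of disjoint dimers inside the column determine the set of edges leaving it, so the matchings
  are counted by the trace of \<open>T ^ m\<close> for a transfer operator \<open>T\<close> on functions of \<open>S\<close> (Lieb, 1967). In terms
  of fermionic creation and annihilation operators, \<open>T\<close> is complementation followed by the commuting product of
  the factors \<open>1 + a (j + 1) a j\<close>, hence conjugation by \<open>T\<close> acts linearly on these operators. After a
  particle-hole exchange on the odd sites and a sine transform it exchanges the orthonormal modes \<open>k\<close> and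
  \<open>k' = n + 1 - k\<close>: \<open>T b k = l k b* k' T\<close> with \<open>l k = c k + sqrt (1 + (c k)^2)\<close>, \<open>c k = cos (k pi / (n + 1))\<close>, and
  \<open>l k' = 1 / l k\<close>.

  Cyclicity of the trace then peels off one mode (for even \<open>m\<close>) or one pair of modes \<open>k, k'\<close> (for odd \<open>m\<close>) at
  a time, leaving a rank-one operator. The trace is the product of the \<open>1 + l k ^ m\<close> over all \<open>k\<close> for even
  \<open>m\<close>, and up to sign the product of the \<open>l k ^ m - l k ^ (- m)\<close> over \<open>2 k \<le> n\<close> for odd \<open>m\<close> and even \<open>n\<close>. The
  sign is irrelevant because the number of matchings is nonnegative.\<close>

section \<open>Fermion operators on functions of subsets\<close>

text \<open>Scalar multiplication is pointwise; with the pointwise addition of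
  \<open>Function_Algebras\<close> it makes \<open>linear\<close> available for operators on
  functions of sets.\<close>

instantiation "fun" :: (type, real_vector) real_vector
begin

definition scaleR_fun_def: "c *\<^sub>R f = (\<lambda>x. c *\<^sub>R f x)"

instance
  by standard (auto simp: scaleR_fun_def fun_eq_iff algebra_simps)

end

lemma scaleR_fun_apply [simp]: "(c *\<^sub>R f) x = c *\<^sub>R f x"
  by (simp add: scaleR_fun_def)

lemma sum_fun_apply: "(\<Sum>i\<in>A. f i) x = (\<Sum>i\<in>A. f i x)"
  by (induction A rule: infinite_finite_induct) auto

type_synonym fock = "nat set \<Rightarrow> real"

definition basis :: "nat set \<Rightarrow> fock" where
  "basis S = (\<lambda>R. if R = S then 1 else 0)"

text \<open>The Jordan--Wigner sign, which makes the operators of distinct sites anticommute.\<close>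

definition sgn_below :: "nat \<Rightarrow> nat set \<Rightarrow> real" where
  "sgn_below j S = (-1) ^ card {i\<in>S. i < j}"

definition cre :: "nat \<Rightarrow> fock \<Rightarrow> fock" where
  "cre j f = (\<lambda>S. if j \<in> S then sgn_below j S * f (S - {j}) else 0)"

definition ann :: "nat \<Rightarrow> fock \<Rightarrow> fock" where
  "ann j f = (\<lambda>S. if j \<notin> S then sgn_below j S * f (insert j S) else 0)"

section \<open>Canonical anticommutation relations\<close>

lemma sgn_below_square [simp]: "sgn_below j S * sgn_below j S = 1"
  by (simp add: sgn_below_def flip: power_mult_distrib)

lemma sgn_below_square' [simp]: "sgn_below j S * (sgn_below j S * x) = x"
  by (simp flip: mult.assoc)

lemma sgn_below_insert:
  "i \<notin> S \<Longrightarrow> sgn_below j (insert i S) = (if i < j then - sgn_below j S else sgn_below j S)"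
proof -
  assume "i \<notin> S"
  have "{k \<in> insert i S. k < j} = (if i < j then insert i {k\<in>S. k < j} else {k\<in>S. k < j})"
    by auto
  moreover have "finite {k\<in>S. k < j}"
    by (rule finite_subset[of _ "{..<j}"]) auto
  ultimately show ?thesis
    using \<open>i \<notin> S\<close> by (simp add: sgn_below_def)
qed

lemma sgn_below_remove:
  "i \<in> S \<Longrightarrow> sgn_below j (S - {i}) = (if i < j then - sgn_below j S else sgn_below j S)"
  using sgn_below_insert[of i "S - {i}" j] by (auto simp: insert_absorb split: if_splits)

text \<open>Removing the smaller of two sites flips the sign attached to the larger one but not
  conversely, so exchanging the order changes the sign. For \<open>i = j\<close> both sides
  vanish.\<close>

lemma cre_cre: "cre i (cre j f) = - cre j (cre i f)"
proof (rule ext)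
  fix S
  have "S - {i} - {j} = S - {j} - {i}" by auto
  then show "cre i (cre j f) S = (- cre j (cre i f)) S"
    by (cases "i = j"; cases i j rule: linorder_cases) (auto simp: cre_def sgn_below_remove)
qed

lemma ann_ann: "ann i (ann j f) = - ann j (ann i f)"
  by (rule ext, cases i j rule: linorder_cases)
    (auto simp: ann_def sgn_below_insert insert_commute)

lemma ann_cre: "ann i (cre j f) = (if i = j then f else 0) - cre j (ann i f)"
proof (rule ext)
  fix S
  have *: "insert i S - {j} = insert i (S - {j})" if "i \<noteq> j" using that by auto
  show "ann i (cre j f) S = ((if i = j then f else 0) - cre j (ann i f)) S"
    by (cases i j rule: linorder_cases)
      (auto simp: ann_def cre_def sgn_below_insert sgn_below_remove * insert_absorb)
qed

lemma linear_cre [simp]: "linear (cre j)"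
  by (rule linearI) (auto simp: cre_def fun_eq_iff algebra_simps)

lemma linear_ann [simp]: "linear (ann j)"
  by (rule linearI) (auto simp: ann_def fun_eq_iff algebra_simps)

section \<open>Operators and traces on the states supported below \<open>n\<close>\<close>

context
  fixes n :: nat
begin

text \<open>\<open>fock\<close> admits arbitrary sets of naturals so that its type does not depend
  on \<open>n\<close>; \<open>supported\<close> singles out the space of dimension 2 ^ n on which
  traces are taken.\<close>

definition supported :: "fock \<Rightarrow> bool" where
  "supported f \<longleftrightarrow> (\<forall>S. \<not> S \<subseteq> {..<n} \<longrightarrow> f S = 0)"

definition fock_op :: "(fock \<Rightarrow> fock) \<Rightarrow> bool" where
  "fock_op X \<longleftrightarrow> linear X \<and> (\<forall>f. supported f \<longrightarrow> supported (X f))"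

definition fock_trace :: "(fock \<Rightarrow> fock) \<Rightarrow> real" where
  "fock_trace X = (\<Sum>S\<in>Pow {..<n}. X (basis S) S)"

lemma supported_basis: "S \<subseteq> {..<n} \<Longrightarrow> supported (basis S)"
  by (auto simp: supported_def basis_def)

lemma supported_expand:
  assumes "supported f"
  shows "f = (\<Sum>S\<in>Pow {..<n}. f S *\<^sub>R basis S)"
proof (rule ext)
  fix R
  have "(\<Sum>S\<in>Pow {..<n}. f S *\<^sub>R basis S) R = (\<Sum>S\<in>Pow {..<n}. if R = S then f S else 0)"
    unfolding sum_fun_apply by (rule sum.cong) (auto simp: basis_def)
  also have "\<dots> = (if R \<in> Pow {..<n} then f R else 0)"
    by (subst sum.delta') auto
  also have "\<dots> = f R"
    using assms by (auto simp: supported_def)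
  finally show "f R = (\<Sum>S\<in>Pow {..<n}. f S *\<^sub>R basis S) R" ..
qed

lemma fock_op_expand:
  assumes "fock_op X" "supported f"
  shows "X f = (\<Sum>S\<in>Pow {..<n}. f S *\<^sub>R X (basis S))"
proof -
  have "linear X" using assms by (simp add: fock_op_def)
  then show ?thesis
    by (subst supported_expand[OF assms(2)]) (simp add: linear_sum linear_scale)
qed

lemma fock_op_comp: "fock_op X \<Longrightarrow> fock_op Y \<Longrightarrow> fock_op (\<lambda>f. X (Y f))"
  using linear_compose[of Y X] by (auto simp: fock_op_def o_def)

lemma fock_op_id: "fock_op (\<lambda>f. f)"
  by (simp add: fock_op_def linear_iff)

lemma fock_op_add: "fock_op X \<Longrightarrow> fock_op Y \<Longrightarrow> fock_op (\<lambda>f. X f + Y f)"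
  by (auto simp: fock_op_def supported_def intro: linear_compose_add)

lemma fock_op_scale: "fock_op X \<Longrightarrow> fock_op (\<lambda>f. c *\<^sub>R X f)"
  by (auto simp: fock_op_def supported_def intro: linear_compose_scale_right)

lemma fock_op_sum: "(\<And>i. i \<in> A \<Longrightarrow> fock_op (X i)) \<Longrightarrow> fock_op (\<lambda>f. \<Sum>i\<in>A. X i f)"
  by (auto simp: fock_op_def supported_def sum_fun_apply intro!: linear_compose_sum)

lemma fock_op_funpow: "fock_op X \<Longrightarrow> fock_op (X ^^ m)"
proof (induction m)
  case 0
  show ?case using fock_op_id by (simp add: id_def)
next
  case (Suc m)
  then show ?case using fock_op_comp[of X "X ^^ m"] by (simp add: o_def)
qed

lemma fock_op_cre:
  assumes "j < n"
  shows "fock_op (cre j)"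
proof -
  have "S - {j} \<subseteq> {..<n} \<longleftrightarrow> S \<subseteq> {..<n}" for S
    using assms by auto
  then show ?thesis
    unfolding fock_op_def supported_def by (simp add: cre_def)
qed

lemma fock_op_ann: "fock_op (ann j)"
  unfolding fock_op_def supported_def by (simp add: ann_def)

lemma fock_op_simps:
  assumes "fock_op X"
  shows "X (f + g) = X f + X g" "X (f - g) = X f - X g" "X (- f) = - X f"
    "X (c *\<^sub>R f) = c *\<^sub>R X f" "X 0 = 0" "X (\<Sum>i\<in>A. h i) = (\<Sum>i\<in>A. X (h i))"
  using assms by (auto simp: fock_op_def linear_add linear_diff linear_neg linear_scale linear_0 linear_sum)

lemma fock_trace_add: "fock_trace (\<lambda>f. X f + Y f) = fock_trace X + fock_trace Y"
  by (simp add: fock_trace_def sum.distrib)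

lemma fock_trace_scale: "fock_trace (\<lambda>f. c *\<^sub>R X f) = c * fock_trace X"
  by (simp add: fock_trace_def sum_distrib_left)

lemma fock_trace_comp:
  assumes "fock_op X" "fock_op Y"
  shows "fock_trace (\<lambda>f. X (Y f)) =
    (\<Sum>S\<in>Pow {..<n}. \<Sum>R\<in>Pow {..<n}. X (basis R) S * Y (basis S) R)"
  unfolding fock_trace_def
proof (rule sum.cong[OF refl])
  fix S assume "S \<in> Pow {..<n}"
  then have "supported (Y (basis S))"
    using assms(2) supported_basis by (auto simp: fock_op_def)
  then show "X (Y (basis S)) S = (\<Sum>R\<in>Pow {..<n}. X (basis R) S * Y (basis S) R)"
    by (subst fock_op_expand[OF assms(1)]) (auto simp: sum_fun_apply mult.commute)
qed

lemma fock_trace_commute: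
  assumes "fock_op X" "fock_op Y"
  shows "fock_trace (\<lambda>f. X (Y f)) = fock_trace (\<lambda>f. Y (X f))"
  unfolding fock_trace_comp[OF assms] fock_trace_comp[OF assms(2,1)]
  by (subst sum.swap) (simp add: mult.commute)

text \<open>Insert \<open>a b + b a = 1\<close>. In the term with \<open>a b\<close>,
  \<open>a\<close> moves to the left of \<open>Y\<close> at the cost of \<open>w\<close>, and
  cyclicity of the trace brings it back on the right, behind \<open>b\<close>.\<close>

lemma fock_trace_eigenmode:
  assumes op: "fock_op Y" "fock_op a" "fock_op b"
    and car: "\<And>f. a (b f) + b (a f) = f"
    and Ya: "\<And>f. Y (a f) = w *\<^sub>R a (Y f)"
  shows "fock_trace Y = (1 + w) * fock_trace (\<lambda>f. Y (b (a f)))"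
proof -
  have "fock_trace Y = fock_trace (\<lambda>f. Y (a (b f) + b (a f)))"
    by (simp add: car)
  also have "\<dots> = fock_trace (\<lambda>f. Y (a (b f))) + fock_trace (\<lambda>f. Y (b (a f)))"
    by (simp add: fock_op_simps[OF op(1)] fock_trace_add)
  also have "fock_trace (\<lambda>f. Y (a (b f))) = w * fock_trace (\<lambda>f. a (Y (b f)))"
    by (simp add: Ya fock_trace_scale)
  also have "fock_trace (\<lambda>f. a (Y (b f))) = fock_trace (\<lambda>f. Y (b (a f)))"
    using fock_trace_commute[OF op(2) fock_op_comp[OF op(1,3)]] .
  finally show ?thesis by (simp add: algebra_simps)
qed

text \<open>The contributions \<open>w\<close> and \<open>- v\<close> come from the states in which exactly one of the modes \<open>a\<close>, \<open>b\<close> is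
  occupied.\<close>

lemma fock_trace_exchange_pair:
  assumes op: "fock_op Y" "fock_op a" "fock_op a'" "fock_op b" "fock_op b'"
    and car: "\<And>f. a (a' f) + a' (a f) = f" "\<And>f. b (b' f) + b' (b f) = f"
      "\<And>f. a' (b' f) = - b' (a' f)"
    and w: "v * w = 1"
    and Y: "\<And>f. Y (a f) = w *\<^sub>R b' (Y f)" "\<And>f. Y (b f) = v *\<^sub>R a' (Y f)"
      "\<And>f. Y (a' f) = v *\<^sub>R b (Y f)"
  shows "fock_trace Y = (w - v) * fock_trace (\<lambda>f. Y (a' (b' f)))"
proof -
  have 1: "fock_trace (\<lambda>f. Y (a (a' f))) = w * fock_trace (\<lambda>f. Y (a' (b' f)))"
    using fock_trace_commute[OF op(5) fock_op_comp[OF op(1,3)]]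
    by (simp add: Y(1) fock_trace_scale)
  have "fock_trace (\<lambda>f. Y (b (b' f))) = v * fock_trace (\<lambda>f. Y (b' (a' f)))"
    using fock_trace_commute[OF op(3) fock_op_comp[OF op(1,5)]]
    by (simp add: Y(2) fock_trace_scale)
  also have "(\<lambda>f. Y (b' (a' f))) = (\<lambda>f. (-1) *\<^sub>R Y (a' (b' f)))"
    by (simp add: car(3) fock_op_simps[OF op(1)])
  finally have 2: "fock_trace (\<lambda>f. Y (b (b' f))) = - v * fock_trace (\<lambda>f. Y (a' (b' f)))"
    by (simp only: fock_trace_scale)
  \<comment> \<open>Here both operators pass through \<open>Y\<close>, where \<open>v\<close> and
    \<open>w\<close> cancel, and cyclicity turns the result into the previous term.\<close>
  have "fock_trace (\<lambda>f. Y (a' (a f))) = fock_trace (\<lambda>f. b (b' (Y f)))"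
    using w by (simp add: Y fock_op_simps[OF op(4)])
  also have "\<dots> = fock_trace (\<lambda>f. Y (b (b' f)))"
    using fock_trace_commute[OF fock_op_comp[OF op(4,5)] op(1)] .
  finally have 3: "fock_trace (\<lambda>f. Y (a' (a f))) = - v * fock_trace (\<lambda>f. Y (a' (b' f)))"
    using 2 by simp
  have "fock_trace Y = fock_trace (\<lambda>f. Y (a (a' f) + a' (a f)))"
    by (simp add: car)
  also have "\<dots> = fock_trace (\<lambda>f. Y (a (a' f))) + fock_trace (\<lambda>f. Y (a' (a f)))"
    by (simp add: fock_op_simps[OF op(1)] fock_trace_add)
  finally show ?thesis using 1 3 by (simp add: algebra_simps)
qed

text \<open>Since \<open>a a' = a a' a a'\<close>, carrying the first factor around the trace places
  two equal operators side by side, so the trace of \<open>Y a a'\<close> vanishes; likewise for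
  \<open>Y a' a\<close>, and the two add up to the trace of \<open>Y\<close>.\<close>

lemma fock_trace_self_exchange:
  assumes op: "fock_op Y" "fock_op a" "fock_op a'"
    and car: "\<And>f. a (a' f) + a' (a f) = f" "\<And>f. a (a f) = 0" "\<And>f. a' (a' f) = 0"
    and Y: "\<And>f. Y (a f) = a' (Y f)" "\<And>f. Y (a' f) = a (Y f)"
  shows "fock_trace Y = 0"
proof -
  have aa: "a (a' (a f)) = a f" "a' (a (a' f)) = a' f" for f
    using car(1)[of "a f"] car(1)[of "a' f"] by (simp_all add: car(2,3) fock_op_simps[OF op(2)] fock_op_simps[OF op(3)])
  have "fock_trace (\<lambda>f. Y (a (a' (a (a' f))))) = fock_trace (\<lambda>f. Y (a' (a (a' (a' f)))))"
    using fock_trace_commute[OF op(3) fock_op_comp[OF op(1) fock_op_comp[OF op(3) fock_op_comp[OF op(2,3)]]]]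
    by (simp add: Y(1))
  moreover have "fock_trace (\<lambda>f. Y (a' (a (a' (a f))))) = fock_trace (\<lambda>f. Y (a (a' (a (a f)))))"
    using fock_trace_commute[OF op(2) fock_op_comp[OF op(1) fock_op_comp[OF op(2) fock_op_comp[OF op(3,2)]]]]
    by (simp add: Y(2))
  moreover have "fock_trace (\<lambda>f. 0) = 0" by (simp add: fock_trace_def)
  ultimately have z: "fock_trace (\<lambda>f. Y (a (a' f))) = 0" "fock_trace (\<lambda>f. Y (a' (a f))) = 0"
    by (simp_all add: aa car(2,3) fock_op_simps[OF op(1)] fock_op_simps[OF op(2)] fock_op_simps[OF op(3)])
  have "fock_trace Y = fock_trace (\<lambda>f. Y (a (a' f) + a' (a f)))"
    by (simp add: car)
  also have "\<dots> = fock_trace (\<lambda>f. Y (a (a' f))) + fock_trace (\<lambda>f. Y (a' (a f)))"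
    by (simp add: fock_op_simps[OF op(1)] fock_trace_add)
  finally show ?thesis using z by simp
qed

end

section \<open>The transfer operator\<close>

definition complement :: "nat \<Rightarrow> fock \<Rightarrow> fock" where
  "complement n f = (\<lambda>S. if S \<subseteq> {..<n} then f ({..<n} - S) else 0)"

text \<open>\<open>ann j\<close> evaluates a function at its argument enlarged by \<open>j\<close>,
  so the factor for \<open>i\<close> either leaves \<open>i\<close> and \<open>Suc i\<close> alone
  or covers both.\<close>

primrec dimers :: "nat \<Rightarrow> fock \<Rightarrow> fock" where
  "dimers 0 f = f"
| "dimers (Suc i) f = dimers i f + ann (Suc i) (ann i (dimers i f))"

declare dimers.simps [simp del]

text \<open>This pulls functions back along the step from one column to the next, see
  \<open>transfer_apply\<close>. For \<open>n = 0\<close> the truncated \<open>n - 1\<close> leaves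
  no dimers.\<close>

definition transfer :: "nat \<Rightarrow> fock \<Rightarrow> fock" where
  "transfer n f = dimers (n - 1) (complement n f)"

lemma fock_op_complement: "fock_op n (complement n)"
  unfolding fock_op_def supported_def
  by (auto intro!: linearI simp: complement_def fun_eq_iff)

lemma fock_op_dimers: "fock_op n (dimers i)"
proof (induction i)
  case 0
  have "dimers 0 = (\<lambda>f. f)" by (rule ext) (rule dimers.simps)
  then show ?case using fock_op_id by metis
next
  case (Suc i)
  have "dimers (Suc i) = (\<lambda>f. dimers i f + ann (Suc i) (ann i (dimers i f)))"
    by (rule ext) (rule dimers.simps)
  then show ?case
    using fock_op_add[OF Suc fock_op_comp[OF fock_op_ann[of n "Suc i"] fock_op_comp[OF fock_op_ann[of n i] Suc]]]
    by metis
qed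

lemma fock_op_transfer: "fock_op n (transfer n)"
  unfolding transfer_def by (rule fock_op_comp[OF fock_op_dimers fock_op_complement])

text \<open>Exactly \<open>j\<close> sites lie below \<open>j\<close>, and each belongs either to
  \<open>S\<close> or to its complement.\<close>

lemma sgn_below_complement:
  assumes "S \<subseteq> {..<n}" "j < n"
  shows "sgn_below j ({..<n} - S) = (-1) ^ j * sgn_below j S"
proof -
  have "{i \<in> {..<n} - S. i < j} \<union> {i\<in>S. i < j} = {..<j}"
    using assms by auto
  then have "card {i \<in> {..<n} - S. i < j} + card {i\<in>S. i < j} = j"
    by (subst card_Un_disjoint[symmetric]) (auto intro: finite_subset[OF _ finite_lessThan[of j]])
  then have "(-1) ^ j = sgn_below j ({..<n} - S) * sgn_below j S"
    unfolding sgn_below_def by (metis power_add)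
  then show ?thesis by (simp add: mult.assoc)
qed

lemma complement_cre:
  assumes "j < n"
  shows "complement n (cre j f) = (-1) ^ j *\<^sub>R ann j (complement n f)"
proof (rule ext)
  fix S
  have "{..<n} - insert j S = {..<n} - S - {j}" by auto
  then show "complement n (cre j f) S = ((-1) ^ j *\<^sub>R ann j (complement n f)) S"
    using assms by (auto simp: complement_def cre_def ann_def sgn_below_complement)
qed

lemma complement_ann:
  assumes "j < n"
  shows "complement n (ann j f) = (-1) ^ j *\<^sub>R cre j (complement n f)"
proof (rule ext)
  fix S
  have "{..<n} - (S - {j}) = insert j ({..<n} - S)" using assms by auto
  then show "complement n (ann j f) S = ((-1) ^ j *\<^sub>R cre j (complement n f)) S"
    using assms by (auto simp: complement_def cre_def ann_def sgn_below_complement subset_iff)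
qed

section \<open>Conjugation by the dimer factors\<close>

lemmas cre_simps = linear_add[OF linear_cre] linear_diff[OF linear_cre] linear_neg[OF linear_cre]
  linear_scale[OF linear_cre] linear_0[OF linear_cre]

lemmas ann_simps = linear_add[OF linear_ann] linear_diff[OF linear_ann] linear_neg[OF linear_ann]
  linear_scale[OF linear_ann] linear_0[OF linear_ann]

lemma ann_ann_ann: "ann i (ann k (ann j f)) = ann j (ann i (ann k f))"
  by (simp add: ann_ann[of k j] ann_ann[of i j] ann_simps)

lemma ann_ann_cre: "ann i (ann k (cre j f)) =
  cre j (ann i (ann k f)) + (if k = j then ann i f else 0) - (if i = j then ann k f else 0)"
  by (auto simp: ann_cre ann_simps cre_simps)

lemma dimer_ann: "ann j f + ann (Suc i) (ann i (ann j f)) = ann j (f + ann (Suc i) (ann i f))"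
  by (simp add: ann_simps ann_ann_ann)

lemma dimers_ann: "dimers i (ann j f) = ann j (dimers i f)"
proof (induction i)
  case 0
  show ?case unfolding dimers.simps ..
next
  case (Suc i)
  show ?case unfolding dimers.simps Suc by (rule dimer_ann)
qed

lemma ann_square [simp]: "ann i (ann i f) = 0"
proof -
  have "ann i (ann i f) S = 0" for S
    by (simp add: ann_def)
  then show ?thesis by (simp add: fun_eq_iff)
qed

text \<open>The induction step of \<open>dimers_cre\<close>, with \<open>f\<close> standing for
  \<open>dimers i f\<close>. Moving the pair of annihilators past \<open>cre j\<close> leaves one
  annihilator when \<open>j\<close> is an end of the new dimer; products with a repeated annihilator
  vanish.\<close>

lemma dimer_cre:
  fixes f :: fock and i j :: nat
  defines "g \<equiv> cre j f + (if j < i then ann (Suc j) f else 0) - (if 1 \<le> j \<and> j \<le> i then ann (j - 1) f else 0)"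
    and "h \<equiv> f + ann (Suc i) (ann i f)"
  shows "g + ann (Suc i) (ann i g) = cre j h + (if j < Suc i then ann (Suc j) h else 0)
    - (if 1 \<le> j \<and> j \<le> Suc i then ann (j - 1) h else 0)"
proof -
  have sq: "ann (Suc i) (ann i (ann i f)) = 0" "ann (Suc i) (ann i (ann (Suc i) f)) = 0" for f
    by (simp_all add: ann_simps ann_ann[of i "Suc i"])
  have sq': "ann i (ann (Suc i) (ann i f)) = 0"
    by (simp add: ann_simps ann_ann[of i "Suc i"])
  have g: "ann (Suc i) (ann i g) = cre j (ann (Suc i) (ann i f)) + (if i = j then ann (Suc i) f else 0)
      - (if Suc i = j then ann i f else 0)
      + (if j < i then ann (Suc j) (ann (Suc i) (ann i f)) else 0)
      - (if 1 \<le> j \<and> j \<le> i then ann (j - 1) (ann (Suc i) (ann i f)) else 0)"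
    by (simp add: g_def ann_simps ann_ann_cre ann_ann_ann[of "Suc i" i])
  consider "j < i" | "j = i" | "j = Suc i" | "j > Suc i" by linarith
  then show ?thesis
    by cases (simp_all add: g, simp_all add: g_def h_def ann_simps cre_simps sq sq')
qed

text \<open>Each dimer at \<open>j\<close> contributes the annihilator of its other end. The
  conditions say which dimers are among the factors: lower end \<open>j\<close> needs
  \<open>j < i\<close>, lower end \<open>j - 1\<close> needs \<open>j \<le> i\<close>.\<close>

lemma dimers_cre: "dimers i (cre j f) = cre j (dimers i f)
  + (if j < i then ann (Suc j) (dimers i f) else 0)
  - (if 1 \<le> j \<and> j \<le> i then ann (j - 1) (dimers i f) else 0)"
proof (induction i)
  case 0
  show ?case unfolding dimers.simps by auto
next
  case (Suc i)
  show ?case unfolding dimers.simps Suc by (rule dimer_cre)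
qed

lemma transfer_cre: "j < n \<Longrightarrow> transfer n (cre j f) = (-1) ^ j *\<^sub>R ann j (transfer n f)"
  by (simp add: transfer_def complement_cre fock_op_simps[OF fock_op_dimers] dimers_ann)

lemma transfer_ann:
  assumes "j < n"
  shows "transfer n (ann j f) = (-1) ^ j *\<^sub>R (cre j (transfer n f)
    + (if Suc j < n then ann (Suc j) (transfer n f) else 0)
    - (if 1 \<le> j then ann (j - 1) (transfer n f) else 0))"
proof -
  have "j < n - 1 \<longleftrightarrow> Suc j < n" "j \<le> n - 1" using assms by auto
  then show ?thesis
    using assms by (simp add: transfer_def complement_ann fock_op_simps[OF fock_op_dimers] dimers_cre)
qed

text \<open>Exchanging particles and holes on the odd sites makes each dimer move a particle from one site to an adjacent
  one. The signs \<open>site_sign\<close> absorb the opposite signs with which the two neighbours enter \<open>transfer_ann\<close>.\<close>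

definition raise :: "nat \<Rightarrow> fock \<Rightarrow> fock" where
  "raise j = (if even j then cre j else ann j)"

definition lower :: "nat \<Rightarrow> fock \<Rightarrow> fock" where
  "lower j = (if even j then ann j else cre j)"

definition site_sign :: "nat \<Rightarrow> real" where
  "site_sign j = (-1) ^ (j div 2)"

definition raise_vec :: "nat \<Rightarrow> (nat \<Rightarrow> real) \<Rightarrow> fock \<Rightarrow> fock" where
  "raise_vec n w f = (\<Sum>j<n. (site_sign j * w j) *\<^sub>R raise j f)"

definition lower_vec :: "nat \<Rightarrow> (nat \<Rightarrow> real) \<Rightarrow> fock \<Rightarrow> fock" where
  "lower_vec n w f = (\<Sum>j<n. (site_sign j * w j) *\<^sub>R lower j f)"

text \<open>The adjacency matrix of the path on \<open>n\<close> sites, applied to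
  \<open>w\<close>.\<close>

definition neighbours :: "nat \<Rightarrow> (nat \<Rightarrow> real) \<Rightarrow> nat \<Rightarrow> real" where
  "neighbours n w j = (if 1 \<le> j then w (j - 1) else 0) + (if Suc j < n then w (Suc j) else 0)"

section \<open>Linear combinations of raising and lowering operators\<close>

lemma fock_op_raise: "j < n \<Longrightarrow> fock_op n (raise j)"
  by (simp add: raise_def fock_op_cre fock_op_ann)

lemma fock_op_lower: "j < n \<Longrightarrow> fock_op n (lower j)"
  by (simp add: lower_def fock_op_cre fock_op_ann)

lemma fock_op_raise_vec: "fock_op n (raise_vec n w)"
proof -
  have "fock_op n (\<lambda>f. \<Sum>j<n. (site_sign j * w j) *\<^sub>R raise j f)"
    by (intro fock_op_sum fock_op_scale fock_op_raise) simp
  then show ?thesis unfolding raise_vec_def .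
qed

lemma fock_op_lower_vec: "fock_op n (lower_vec n w)"
proof -
  have "fock_op n (\<lambda>f. \<Sum>j<n. (site_sign j * w j) *\<^sub>R lower j f)"
    by (intro fock_op_sum fock_op_scale fock_op_lower) simp
  then show ?thesis unfolding lower_vec_def .
qed

text \<open>For different parities one operator is a creator and the other an annihilator; then the
  sites differ, so the anticommutator vanishes as well.\<close>

lemma raise_raise: "raise i (raise j f) = - raise j (raise i f)"
  using ann_cre[of i j f] ann_cre[of j i f] by (auto simp: raise_def cre_cre[of i j] ann_ann[of i j])

lemma lower_lower: "lower i (lower j f) = - lower j (lower i f)"
  using ann_cre[of i j f] ann_cre[of j i f] by (auto simp: lower_def cre_cre[of i j] ann_ann[of i j])

lemma raise_lower: "raise i (lower j f) + lower j (raise i f) = (if i = j then f else 0)"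
  using ann_cre[of i j f] ann_cre[of j i f]
  by (auto simp: lower_def raise_def cre_cre[of i j] ann_ann[of i j])

lemma site_sign_square [simp]: "site_sign j * site_sign j = 1"
  by (simp add: site_sign_def flip: power_mult_distrib)

lemma raise_vec_raise_vec: "raise_vec n u (raise_vec n v f) = - raise_vec n v (raise_vec n u f)"
proof -
  have "raise_vec n u (raise_vec n v f) =
      (\<Sum>i<n. \<Sum>j<n. (site_sign i * u i * (site_sign j * v j)) *\<^sub>R raise i (raise j f))"
    unfolding raise_vec_def
    by (simp add: fock_op_simps[OF fock_op_raise] scaleR_sum_right)
  also have "\<dots> = (\<Sum>i<n. \<Sum>j<n. - ((site_sign j * v j * (site_sign i * u i)) *\<^sub>R raise j (raise i f)))"
    by (subst raise_raise) (simp add: mult_ac)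
  also have "\<dots> = (\<Sum>j<n. \<Sum>i<n. - ((site_sign j * v j * (site_sign i * u i)) *\<^sub>R raise j (raise i f)))"
    by (rule sum.swap)
  also have "\<dots> = - raise_vec n v (raise_vec n u f)"
    unfolding raise_vec_def
    by (simp add: fock_op_simps[OF fock_op_raise] scaleR_sum_right sum_negf)
  finally show ?thesis .
qed

lemma lower_vec_lower_vec: "lower_vec n u (lower_vec n v f) = - lower_vec n v (lower_vec n u f)"
proof -
  have "lower_vec n u (lower_vec n v f) =
      (\<Sum>i<n. \<Sum>j<n. (site_sign i * u i * (site_sign j * v j)) *\<^sub>R lower i (lower j f))"
    unfolding lower_vec_def
    by (simp add: fock_op_simps[OF fock_op_lower] scaleR_sum_right)
  also have "\<dots> = (\<Sum>i<n. \<Sum>j<n. - ((site_sign j * v j * (site_sign i * u i)) *\<^sub>R lower j (lower i f)))"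
    by (subst lower_lower) (simp add: mult_ac)
  also have "\<dots> = (\<Sum>j<n. \<Sum>i<n. - ((site_sign j * v j * (site_sign i * u i)) *\<^sub>R lower j (lower i f)))"
    by (rule sum.swap)
  also have "\<dots> = - lower_vec n v (lower_vec n u f)"
    unfolding lower_vec_def
    by (simp add: fock_op_simps[OF fock_op_lower] scaleR_sum_right sum_negf)
  finally show ?thesis .
qed

text \<open>Only the diagonal terms survive, and there the squares of \<open>site_sign\<close> are
  1.\<close>

lemma raise_vec_lower_vec:
  "raise_vec n u (lower_vec n v f) + lower_vec n v (raise_vec n u f) = (\<Sum>j<n. u j * v j) *\<^sub>R f"
proof -
  let ?c = "\<lambda>i j. site_sign i * u i * (site_sign j * v j)"
  have 1: "raise_vec n u (lower_vec n v f) = (\<Sum>i<n. \<Sum>j<n. ?c i j *\<^sub>R raise i (lower j f))"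
    unfolding raise_vec_def lower_vec_def
    by (simp add: fock_op_simps[OF fock_op_raise] scaleR_sum_right)
  have "lower_vec n v (raise_vec n u f) = (\<Sum>j<n. \<Sum>i<n. ?c i j *\<^sub>R lower j (raise i f))"
    unfolding raise_vec_def lower_vec_def
    by (simp add: fock_op_simps[OF fock_op_lower] scaleR_sum_right mult_ac)
  also have "\<dots> = (\<Sum>i<n. \<Sum>j<n. ?c i j *\<^sub>R lower j (raise i f))"
    by (rule sum.swap)
  finally have 2: "lower_vec n v (raise_vec n u f) = (\<Sum>i<n. \<Sum>j<n. ?c i j *\<^sub>R lower j (raise i f))" .
  have "raise_vec n u (lower_vec n v f) + lower_vec n v (raise_vec n u f)
      = (\<Sum>i<n. \<Sum>j<n. ?c i j *\<^sub>R (if i = j then f else 0))"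
    unfolding 1 2 raise_lower[symmetric] by (simp add: sum.distrib scaleR_add_right)
  also have "\<dots> = (\<Sum>i<n. \<Sum>j<n. if i = j then ?c i j *\<^sub>R f else 0)"
    by (intro sum.cong) auto
  also have "\<dots> = (\<Sum>i<n. (u i * v i) *\<^sub>R f)"
  proof (rule sum.cong[OF refl])
    fix i assume "i \<in> {..<n}"
    have "?c i i = site_sign i * site_sign i * (u i * v i)" by (simp only: mult_ac)
    then show "(\<Sum>j<n. if i = j then ?c i j *\<^sub>R f else 0) = (u i * v i) *\<^sub>R f"
      using \<open>i \<in> {..<n}\<close> by (simp add: sum.delta)
  qed
  finally show ?thesis by (simp add: scaleR_sum_left)
qed

section \<open>Action of the transfer operator on linear combinations\<close>

lemma sum_shift_lessThan:
  fixes F :: "nat \<Rightarrow> 'a::comm_monoid_add"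
  shows "(\<Sum>j<n. if Suc j < n then F j else 0) = (\<Sum>j<n. if 1 \<le> j then F (j - 1) else 0)"
proof (cases n)
  case (Suc m)
  have "(\<Sum>j<Suc m. if Suc j < Suc m then F j else 0) = (\<Sum>j<m. F j)"
    by simp
  also have "\<dots> = (\<Sum>j<Suc m. if 1 \<le> j then F (j - 1) else 0)"
    by (simp only: sum.lessThan_Suc_shift) simp
  finally show ?thesis using Suc by simp
qed simp

lemma site_sign_Suc: "site_sign (Suc j) = (if even j then site_sign j else - site_sign j)"
  by (auto simp: site_sign_def elim!: evenE oddE)

lemma site_sign_pred:
  "1 \<le> j \<Longrightarrow> site_sign (j - 1) = (if even j then - site_sign j else site_sign j)"
  using site_sign_Suc[of "j - 1"] by (cases "even j") auto

text \<open>Reindexing: coefficients at \<open>j\<close> of neighbouring operators become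
  coefficients of the neighbours at the operator of \<open>j\<close>. \<open>P\<close> selects the
  parity of the sites with neighbour terms.\<close>

lemma sum_neighbours:
  fixes G :: "nat \<Rightarrow> fock"
  shows "(\<Sum>j<n. (site_sign j * w j) *\<^sub>R (if P j then
      (if Suc j < n then G (Suc j) else 0) - (if 1 \<le> j then G (j - 1) else 0) else 0))
   = (\<Sum>j<n. (if 1 \<le> j \<and> P (j - 1) then (site_sign (j - 1) * w (j - 1)) *\<^sub>R G j else 0)
       - (if Suc j < n \<and> P (Suc j) then (site_sign (Suc j) * w (Suc j)) *\<^sub>R G j else 0))"
proof -
  let ?F = "\<lambda>j. if P j then (site_sign j * w j) *\<^sub>R G (Suc j) else 0"
  let ?H = "\<lambda>j. if P (Suc j) then (site_sign (Suc j) * w (Suc j)) *\<^sub>R G j else 0"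
  have "(\<Sum>j<n. (site_sign j * w j) *\<^sub>R (if P j then
      (if Suc j < n then G (Suc j) else 0) - (if 1 \<le> j then G (j - 1) else 0) else 0))
    = (\<Sum>j<n. if Suc j < n then ?F j else 0) - (\<Sum>j<n. if 1 \<le> j then ?H (j - 1) else 0)"
    unfolding sum_subtractf[symmetric] by (rule sum.cong) (auto simp: scaleR_diff_right)
  also have "\<dots> = (\<Sum>j<n. if 1 \<le> j then ?F (j - 1) else 0) - (\<Sum>j<n. if Suc j < n then ?H j else 0)"
    unfolding sum_shift_lessThan ..
  also have "\<dots> = (\<Sum>j<n. (if 1 \<le> j \<and> P (j - 1) then (site_sign (j - 1) * w (j - 1)) *\<^sub>R G j else 0)
       - (if Suc j < n \<and> P (Suc j) then (site_sign (Suc j) * w (Suc j)) *\<^sub>R G j else 0))"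
    unfolding sum_subtractf[symmetric] by (rule sum.cong) auto
  finally show ?thesis .
qed

text \<open>Only the annihilators at odd sites produce neighbour terms; these sit at even sites,
  where \<open>ann\<close> is \<open>lower\<close>. Hence only lowering operators appear.\<close>

lemma transfer_raise_vec:
  "transfer n (raise_vec n w f) =
    lower_vec n (\<lambda>j. if even j then w j + neighbours n w j else - w j) (transfer n f)"
proof -
  let ?g = "transfer n f"
  have "transfer n (raise_vec n w f) = (\<Sum>j<n. (site_sign j * w j) *\<^sub>R transfer n (raise j f))"
    by (simp add: raise_vec_def fock_op_simps[OF fock_op_transfer])
  also have "\<dots> = (\<Sum>j<n. (site_sign j * w j) *\<^sub>R (if even j then lower j ?g else - lower j ?g)
     - (site_sign j * w j) *\<^sub>R (if odd j then (if Suc j < n then ann (Suc j) ?g else 0)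
          - (if 1 \<le> j then ann (j - 1) ?g else 0) else 0))"
    by (rule sum.cong) (auto simp: raise_def lower_def transfer_cre transfer_ann algebra_simps)
  also have "\<dots> = (\<Sum>j<n. (site_sign j * w j) *\<^sub>R (if even j then lower j ?g else - lower j ?g)
     - ((if 1 \<le> j \<and> odd (j - 1) then (site_sign (j - 1) * w (j - 1)) *\<^sub>R ann j ?g else 0)
       - (if Suc j < n \<and> odd (Suc j) then (site_sign (Suc j) * w (Suc j)) *\<^sub>R ann j ?g else 0)))"
    unfolding sum_subtractf sum_neighbours[where w = w and P = odd and G = "\<lambda>j. ann j ?g" and n = n, unfolded sum_subtractf] ..
  also have "\<dots> = lower_vec n (\<lambda>j. if even j then w j + neighbours n w j else - w j) ?g"
    unfolding lower_vec_def
  proof (rule sum.cong[OF refl])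
    fix j
    show "(site_sign j * w j) *\<^sub>R (if even j then lower j ?g else - lower j ?g)
     - ((if 1 \<le> j \<and> odd (j - 1) then (site_sign (j - 1) * w (j - 1)) *\<^sub>R ann j ?g else 0)
       - (if Suc j < n \<and> odd (Suc j) then (site_sign (Suc j) * w (Suc j)) *\<^sub>R ann j ?g else 0))
      = (site_sign j * (if even j then w j + neighbours n w j else - w j)) *\<^sub>R lower j ?g"
      using site_sign_Suc[of j] site_sign_pred[of j]
      by (auto simp: lower_def neighbours_def algebra_simps)
  qed
  finally show ?thesis .
qed

text \<open>Now the annihilators sit at even sites and their neighbours at odd sites, where
  \<open>ann\<close> is \<open>raise\<close>.\<close>

lemma transfer_lower_vec:
  "transfer n (lower_vec n w f) =
    raise_vec n (\<lambda>j. if even j then w j else neighbours n w j - w j) (transfer n f)"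
proof -
  let ?g = "transfer n f"
  have "transfer n (lower_vec n w f) = (\<Sum>j<n. (site_sign j * w j) *\<^sub>R transfer n (lower j f))"
    by (simp add: lower_vec_def fock_op_simps[OF fock_op_transfer])
  also have "\<dots> = (\<Sum>j<n. (site_sign j * w j) *\<^sub>R (if even j then raise j ?g else - raise j ?g)
     + (site_sign j * w j) *\<^sub>R (if even j then (if Suc j < n then ann (Suc j) ?g else 0)
          - (if 1 \<le> j then ann (j - 1) ?g else 0) else 0))"
    by (rule sum.cong) (auto simp: raise_def lower_def transfer_cre transfer_ann algebra_simps)
  also have "\<dots> = (\<Sum>j<n. (site_sign j * w j) *\<^sub>R (if even j then raise j ?g else - raise j ?g)
     + ((if 1 \<le> j \<and> even (j - 1) then (site_sign (j - 1) * w (j - 1)) *\<^sub>R ann j ?g else 0)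
       - (if Suc j < n \<and> even (Suc j) then (site_sign (Suc j) * w (Suc j)) *\<^sub>R ann j ?g else 0)))"
    unfolding sum.distrib sum_neighbours[where w = w and P = even and G = "\<lambda>j. ann j ?g" and n = n] ..
  also have "\<dots> = raise_vec n (\<lambda>j. if even j then w j else neighbours n w j - w j) ?g"
    unfolding raise_vec_def
  proof (rule sum.cong[OF refl])
    fix j
    show "(site_sign j * w j) *\<^sub>R (if even j then raise j ?g else - raise j ?g)
     + ((if 1 \<le> j \<and> even (j - 1) then (site_sign (j - 1) * w (j - 1)) *\<^sub>R ann j ?g else 0)
       - (if Suc j < n \<and> even (Suc j) then (site_sign (Suc j) * w (Suc j)) *\<^sub>R ann j ?g else 0))
      = (site_sign j * (if even j then w j else neighbours n w j - w j)) *\<^sub>R raise j ?g"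
      using site_sign_Suc[of j] site_sign_pred[of j]
      by (auto simp: raise_def neighbours_def algebra_simps)
  qed
  finally show ?thesis .
qed

section \<open>Diagonalisation\<close>

lemma ann_basis: "j \<notin> S \<Longrightarrow> ann j (basis S) = 0"
  by (auto simp: ann_def basis_def fun_eq_iff)

lemma cre_basis: "j \<in> S \<Longrightarrow> cre j (basis S) = 0"
  by (auto simp: cre_def basis_def fun_eq_iff)

text \<open>The odd sites form the state killed by every \<open>lower j\<close> with
  \<open>j < n\<close>, the even sites the one killed by every \<open>raise j\<close>: the empty and
  the full state after the particle-hole exchange.\<close>

definition site_class :: "nat \<Rightarrow> bool \<Rightarrow> nat set" where
  "site_class n b = {j. j < n \<and> (even j \<longleftrightarrow> b)}"

lemma complement_basis:
  assumes "S \<subseteq> {..<n}"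
  shows "complement n (basis S) = basis ({..<n} - S)"
  using assms by (auto simp: complement_def basis_def fun_eq_iff)

text \<open>Adjacent sites have opposite parities, so one of the two annihilators of each dimer
  meets an empty site.\<close>

lemma dimers_site_class: "dimers i (basis (site_class n b)) = basis (site_class n b)"
proof (induction i)
  case 0
  show ?case unfolding dimers.simps ..
next
  case (Suc i)
  have "ann (Suc i) (ann i (basis (site_class n b))) = 0"
  proof (cases "i \<in> site_class n b")
    case True
    then have "Suc i \<notin> site_class n b" by (auto simp: site_class_def)
    then show ?thesis by (subst ann_ann) (simp add: ann_basis ann_simps)
  next
    case False
    then show ?thesis by (simp add: ann_basis ann_simps)
  qed
  then show ?case unfolding dimers.simps Suc by simp
qed

lemma transfer_site_class: "transfer n (basis (site_class n b)) = basis (site_class n (\<not> b))"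
proof -
  have "{..<n} - site_class n b = site_class n (\<not> b)" "site_class n b \<subseteq> {..<n}"
    by (auto simp: site_class_def)
  then show ?thesis by (simp add: transfer_def complement_basis dimers_site_class)
qed

lemma lower_odd_sites: "j < n \<Longrightarrow> lower j (basis (site_class n False)) = 0"
  by (auto simp: lower_def ann_basis cre_basis site_class_def)

lemma basis_nonzero [simp]: "basis S \<noteq> 0"
  by (auto simp: basis_def fun_eq_iff)

section \<open>Eigenvalues and sine modes\<close>

definition mode_cos :: "nat \<Rightarrow> nat \<Rightarrow> real" where
  "mode_cos n k = cos (real k * pi / (real n + 1))"

definition mode_ev :: "nat \<Rightarrow> nat \<Rightarrow> real" where
  "mode_ev n k = mode_cos n k + sqrt (1 + (mode_cos n k)\<^sup>2)"

text \<open>The shift \<open>real j + 1\<close> puts the zeros of the sine at the positions 0 and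
  \<open>n + 1\<close> just outside the column.\<close>

definition mode_sin :: "nat \<Rightarrow> nat \<Rightarrow> nat \<Rightarrow> real" where
  "mode_sin n k j = sin (real k * (real j + 1) * pi / (real n + 1))"

text \<open>With an amplitude \<open>p\<close> on the even and \<open>q\<close> on the odd sites, the condition that \<open>transfer_raise_vec\<close> and
  \<open>transfer_lower_vec\<close> yield proportional vectors is \<open>q^2 - 2 c p q - p^2 = 0\<close>; the choice is \<open>p = 1\<close>, \<open>q = mode_ev n k\<close>.\<close>

definition mode_vec :: "nat \<Rightarrow> nat \<Rightarrow> nat \<Rightarrow> real" where
  "mode_vec n k j = (if even j then mode_sin n k j else mode_ev n k * mode_sin n k j)"

lemma mode_ev_pos: "mode_ev n k > 0"
proof -
  have "\<bar>mode_cos n k\<bar> < sqrt (1 + (mode_cos n k)\<^sup>2)"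
    by (rule real_less_rsqrt) simp
  then show ?thesis by (simp add: mode_ev_def)
qed

lemma mode_cos_mirror: "k \<le> n \<Longrightarrow> mode_cos n (n + 1 - k) = - mode_cos n k"
proof -
  assume "k \<le> n"
  then have "real (n + 1 - k) * pi / (real n + 1) = pi - real k * pi / (real n + 1)"
    by (simp add: of_nat_diff field_simps)
  then show ?thesis by (simp add: mode_cos_def)
qed

lemma mode_ev_mult_conj: "mode_ev n k * (sqrt (1 + (mode_cos n k)\<^sup>2) - mode_cos n k) = 1"
proof -
  have "(sqrt (1 + (mode_cos n k)\<^sup>2))\<^sup>2 = 1 + (mode_cos n k)\<^sup>2"
    by (rule real_sqrt_pow2) (simp add: add_nonneg_nonneg)
  then show ?thesis by (simp add: mode_ev_def algebra_simps power2_eq_square)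
qed

lemma mode_ev_mirror: "k \<le> n \<Longrightarrow> mode_ev n (n + 1 - k) = inverse (mode_ev n k)"
proof -
  assume "k \<le> n"
  then have "mode_ev n (n + 1 - k) = sqrt (1 + (mode_cos n k)\<^sup>2) - mode_cos n k"
    unfolding mode_ev_def by (simp only: mode_cos_mirror power2_minus)
  then have "mode_ev n k * mode_ev n (n + 1 - k) = 1"
    using mode_ev_mult_conj by simp
  then show ?thesis by (rule inverse_unique[symmetric])
qed

text \<open>The quadratic condition on the amplitudes of \<open>mode_vec\<close>, at
  \<open>p = 1\<close> and \<open>q = mode_ev n k\<close>.\<close>

lemma mode_ev_square: "(mode_ev n k)\<^sup>2 = 1 + 2 * mode_cos n k * mode_ev n k"
  using mode_ev_mult_conj[of n k] by (simp add: mode_ev_def algebra_simps power2_eq_square)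

text \<open>Mirroring \<open>k\<close> replaces the angle t by (j + 1) pi - t; the sign comes from
  cos ((j + 1) pi).\<close>

lemma mode_sin_mirror:
  assumes "k \<le> n"
  shows "mode_sin n (n + 1 - k) j = (if even j then mode_sin n k j else - mode_sin n k j)"
proof -
  have "real (n + 1 - k) * (real j + 1) * pi / (real n + 1)
      = real (j + 1) * pi - real k * (real j + 1) * pi / (real n + 1)"
    using assms by (simp add: of_nat_diff field_simps)
  then have "mode_sin n (n + 1 - k) j = - (cos (real (j + 1) * pi) * mode_sin n k j)"
    unfolding mode_sin_def by (simp only: sin_diff sin_npi)
  then show ?thesis by (auto simp: cos_npi simp del: of_nat_add of_nat_Suc)
qed

text \<open>The addition theorem; at the ends of the column a vanishing sine stands in for the
  missing neighbour.\<close>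

lemma neighbours_mode_sin:
  assumes "j < n"
  shows "neighbours n (mode_sin n k) j = 2 * mode_cos n k * mode_sin n k j"
proof -
  define t where "t = real k * pi / (real n + 1)"
  have s: "mode_sin n k i = sin ((real i + 1) * t)" for i
    by (simp add: mode_sin_def t_def field_simps)
  have l: "(if 1 \<le> j then mode_sin n k (j - 1) else 0) = sin ((real j + 1) * t - t)"
    by (cases j) (auto simp: s algebra_simps)
  have "(real n + 1) * t = real k * pi"
    by (simp add: t_def)
  then have "sin ((real n + 1) * t) = 0"
    by simp
  moreover have "Suc j = n" if "\<not> Suc j < n" using that assms by simp
  ultimately have r: "(if Suc j < n then mode_sin n k (Suc j) else 0) = sin ((real j + 1) * t + t)"
    by (auto simp: s algebra_simps)
  have "neighbours n (mode_sin n k) j = sin ((real j + 1) * t - t) + sin ((real j + 1) * t + t)"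
    unfolding neighbours_def l r ..
  also have "\<dots> = 2 * cos t * sin ((real j + 1) * t)"
    by (simp only: sin_add sin_diff) simp
  finally show ?thesis by (simp add: mode_cos_def s t_def)
qed

lemma neighbours_mode_vec:
  assumes "j < n"
  shows "neighbours n (mode_vec n k) j =
    2 * mode_cos n k * mode_sin n k j * (if even j then mode_ev n k else 1)"
proof -
  have "neighbours n (mode_vec n k) j = neighbours n (mode_sin n k) j * (if even j then mode_ev n k else 1)"
    by (auto simp: neighbours_def mode_vec_def algebra_simps)
  then show ?thesis using neighbours_mode_sin[OF assms] by simp
qed

lemma raise_vec_cong: "(\<And>j. j < n \<Longrightarrow> u j = v j) \<Longrightarrow> raise_vec n u f = raise_vec n v f"
  by (simp add: raise_vec_def)

lemma lower_vec_cong: "(\<And>j. j < n \<Longrightarrow> u j = v j) \<Longrightarrow> lower_vec n u f = lower_vec n v f"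
  by (simp add: lower_vec_def)

lemma raise_vec_scale: "raise_vec n (\<lambda>j. c * u j) f = c *\<^sub>R raise_vec n u f"
  by (simp add: raise_vec_def scaleR_sum_right mult_ac)

lemma lower_vec_scale: "lower_vec n (\<lambda>j. c * u j) f = c *\<^sub>R lower_vec n u f"
  by (simp add: lower_vec_def scaleR_sum_right mult_ac)

text \<open>On even sites this is \<open>mode_ev_square\<close>; on odd sites one factor
  \<open>mode_ev n k\<close> cancels the inverse in the mirrored mode. The modes are not normalised
  yet, hence the square.\<close>

lemma transfer_raise_mode:
  assumes "k \<le> n"
  shows "transfer n (raise_vec n (mode_vec n k) f) =
    (mode_ev n k)\<^sup>2 *\<^sub>R lower_vec n (mode_vec n (n + 1 - k)) (transfer n f)"
  unfolding transfer_raise_vec lower_vec_scale[symmetric]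
proof (rule lower_vec_cong)
  fix j assume "j < n"
  have "(mode_ev n k)\<^sup>2 * (inverse (mode_ev n k) * x) = mode_ev n k * x" for x
    using mode_ev_pos[of n k] by (simp add: power2_eq_square)
  then show "(if even j then mode_vec n k j + neighbours n (mode_vec n k) j else - mode_vec n k j) =
      (mode_ev n k)\<^sup>2 * mode_vec n (n + 1 - k) j"
    unfolding neighbours_mode_vec[OF \<open>j < n\<close>] mode_vec_def mode_sin_mirror[OF assms] mode_ev_mirror[OF assms]
    by (cases "even j") (simp_all add: mode_ev_square distrib_right)
qed

lemma transfer_lower_mode:
  assumes "k \<le> n"
  shows "transfer n (lower_vec n (mode_vec n k) f) =
    raise_vec n (mode_vec n (n + 1 - k)) (transfer n f)"
  unfolding transfer_lower_vec
proof (rule raise_vec_cong)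
  fix j assume "j < n"
  have inv: "inverse (mode_ev n k) = mode_ev n k - 2 * mode_cos n k"
    using mode_ev_square[of n k] mode_ev_pos[of n k] by (simp add: field_simps power2_eq_square)
  show "(if even j then mode_vec n k j else neighbours n (mode_vec n k) j - mode_vec n k j) =
      mode_vec n (n + 1 - k) j"
    unfolding neighbours_mode_vec[OF \<open>j < n\<close>] mode_vec_def mode_sin_mirror[OF assms] mode_ev_mirror[OF assms] inv
    by (auto simp: algebra_simps)
qed

section \<open>Orthonormality and completeness of the modes\<close>

lemma mode_angle_less_pi: "k \<le> n \<Longrightarrow> real k * pi / (real n + 1) < pi"
proof -
  assume "k \<le> n"
  then have "real k * pi < (real n + 1) * pi"
    by (intro mult_strict_right_mono) auto
  then show ?thesis by (simp add: divide_less_eq mult.commute)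
qed

text \<open>The cosine decreases on [0, pi], and x + sqrt (1 + x^2) = exp (arsinh x)
  increases.\<close>

lemma mode_ev_strict_antimono:
  assumes "k < l" "l \<le> n"
  shows "mode_ev n l < mode_ev n k"
proof -
  have "real k * pi / (real n + 1) < real l * pi / (real n + 1)"
    using assms by (intro divide_strict_right_mono mult_strict_right_mono) auto
  then have c: "mode_cos n l < mode_cos n k"
    unfolding mode_cos_def using mode_angle_less_pi[OF assms(2)]
    by (intro cos_monotone_0_pi) auto
  have mono: "x + sqrt (1 + x\<^sup>2) < y + sqrt (1 + y\<^sup>2)" if "x < y" for x y :: real
  proof -
    have "arsinh x < arsinh y" using that by simp
    then have "ln (x + sqrt (x\<^sup>2 + 1)) < ln (y + sqrt (y\<^sup>2 + 1))"
      by (simp add: arsinh_real_def)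
    then show ?thesis
      using arsinh_real_aux[of x] arsinh_real_aux[of y] by (simp add: add.commute)
  qed
  show ?thesis unfolding mode_ev_def using mono[OF c] .
qed

lemma mode_ev_inj: "k \<le> n \<Longrightarrow> l \<le> n \<Longrightarrow> mode_ev n k = mode_ev n l \<Longrightarrow> k = l"
  by (metis less_irrefl mode_ev_strict_antimono nat_neq_iff)

abbreviation mode_inner :: "nat \<Rightarrow> nat \<Rightarrow> nat \<Rightarrow> real" where
  "mode_inner n k l \<equiv> (\<Sum>j<n. mode_vec n k j * mode_vec n l j)"

text \<open>The anticommutator of two modes is the scalar \<open>mode_inner\<close>, so moving it through the transfer operator relates
  the inner products. This gives orthogonality and the ratio of the norms without any trigonometric sum.\<close>

lemma mode_inner_mirror:
  assumes "k \<le> n" "l \<le> n"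
  shows "mode_inner n k l = (mode_ev n k)\<^sup>2 * mode_inner n (n + 1 - l) (n + 1 - k)"
proof -
  \<comment> \<open>A test vector whose image under the transfer operator is again a basis state, so
    that scalars can be compared.\<close>
  let ?T = "transfer n" and ?f = "basis (site_class n True)"
  have "mode_inner n k l *\<^sub>R ?T ?f =
     ?T (raise_vec n (mode_vec n k) (lower_vec n (mode_vec n l) ?f)
      + lower_vec n (mode_vec n l) (raise_vec n (mode_vec n k) ?f))"
    unfolding raise_vec_lower_vec by (simp add: fock_op_simps[OF fock_op_transfer])
  also have "\<dots> = (mode_ev n k)\<^sup>2 *\<^sub>R
     (raise_vec n (mode_vec n (n + 1 - l)) (lower_vec n (mode_vec n (n + 1 - k)) (?T ?f))
      + lower_vec n (mode_vec n (n + 1 - k)) (raise_vec n (mode_vec n (n + 1 - l)) (?T ?f)))"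
    using assms by (simp add: fock_op_simps[OF fock_op_transfer] transfer_raise_mode transfer_lower_mode
        fock_op_simps[OF fock_op_raise_vec] scaleR_add_right)
  also have "\<dots> = (mode_ev n k)\<^sup>2 *\<^sub>R mode_inner n (n + 1 - l) (n + 1 - k) *\<^sub>R ?T ?f"
    unfolding raise_vec_lower_vec ..
  finally show ?thesis
    using basis_nonzero[of "site_class n False"] by (simp add: transfer_site_class)
qed

text \<open>Mirroring twice returns the same inner product with the factor
  \<open>(mode_ev n k / mode_ev n l)^2\<close>, which is not 1 because the eigenvalues are positive
  and distinct.\<close>

lemma mode_inner_orthogonal:
  assumes "k \<in> {1..n}" "l \<in> {1..n}" "k \<noteq> l"
  shows "mode_inner n k l = 0"
proof -
  have le: "k \<le> n" "l \<le> n" "n + 1 - k \<le> n" "n + 1 - l \<le> n" and mm: "n + 1 - (n + 1 - l) = l" "n + 1 - (n + 1 - k) = k"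
    using assms by auto
  have "mode_inner n k l = (mode_ev n k)\<^sup>2 * ((mode_ev n (n + 1 - l))\<^sup>2 * mode_inner n k l)"
    using mode_inner_mirror[OF le(1,2)] mode_inner_mirror[OF le(4,3), unfolded mm] by (rule trans[OF _ arg_cong])
  then have "(1 - (mode_ev n k)\<^sup>2 * (inverse (mode_ev n l))\<^sup>2) * mode_inner n k l = 0"
    unfolding mode_ev_mirror[OF le(2)] by (simp add: algebra_simps)
  moreover have "(mode_ev n k)\<^sup>2 \<noteq> (mode_ev n l)\<^sup>2"
    using mode_ev_inj[OF le(1,2)] assms(3) mode_ev_pos[of n k] mode_ev_pos[of n l]
    by (auto simp: power2_eq_iff_nonneg)
  ultimately show ?thesis
    using mode_ev_pos[of n l] by (auto simp: field_simps)
qed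

lemma mode_inner_pos:
  assumes "k \<in> {1..n}"
  shows "mode_inner n k k > 0"
proof -
  have "mode_vec n k 0 > 0"
    using assms mode_angle_less_pi[of k n] by (auto simp: mode_vec_def mode_sin_def intro!: sin_gt_zero)
  moreover have "(0::nat) \<in> {..<n}" using assms by auto
  ultimately show ?thesis
    by (intro sum_pos2[of _ 0]) auto
qed

definition unit_mode :: "nat \<Rightarrow> nat \<Rightarrow> nat \<Rightarrow> real" where
  "unit_mode n k = (\<lambda>j. (1 / sqrt (mode_inner n k k)) * mode_vec n k j)"

lemma unit_mode_orthonormal:
  assumes "k \<in> {1..n}" "l \<in> {1..n}"
  shows "(\<Sum>j<n. unit_mode n k j * unit_mode n l j) = (if k = l then 1 else 0)"
proof -
  have "(\<Sum>j<n. unit_mode n k j * unit_mode n l j) =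
      1 / sqrt (mode_inner n k k) * (1 / sqrt (mode_inner n l l)) * mode_inner n k l"
    unfolding sum_distrib_left unit_mode_def by (simp add: mult_ac)
  then show ?thesis
    using mode_inner_orthogonal[OF assms] mode_inner_pos[OF assms(1)] by auto
qed

text \<open>After normalisation this ratio turns the factors \<open>(mode_ev n k)^2\<close> and 1 of
  \<open>transfer_raise_mode\<close> and \<open>transfer_lower_mode\<close> into
  \<open>mode_ev n k\<close> and its inverse.\<close>

lemma sqrt_mode_inner_mirror:
  assumes "k \<in> {1..n}"
  shows "sqrt (mode_inner n k k) = mode_ev n k * sqrt (mode_inner n (n + 1 - k) (n + 1 - k))"
proof -
  have "sqrt (mode_inner n k k) = sqrt ((mode_ev n k)\<^sup>2 * mode_inner n (n + 1 - k) (n + 1 - k))"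
    using assms by (intro arg_cong[where f = sqrt] mode_inner_mirror) auto
  also have "\<dots> = mode_ev n k * sqrt (mode_inner n (n + 1 - k) (n + 1 - k))"
    using mode_ev_pos[of n k] by (simp add: real_sqrt_mult)
  finally show ?thesis .
qed

text \<open>A square matrix with orthonormal rows also has orthonormal columns. Matrix indices start
  at 0 and mode numbers at 1, hence the \<open>Suc k\<close>.\<close>

lemma unit_mode_complete:
  assumes "i < n" "j < n"
  shows "(\<Sum>k=1..n. unit_mode n k i * unit_mode n k j) = (if i = j then 1 else 0)"
proof -
  let ?A = "mat n n (\<lambda>(k, j). unit_mode n (Suc k) j)"
  let ?B = "mat n n (\<lambda>(j, k). unit_mode n (Suc k) j)"
  have "?A * ?B = 1\<^sub>m n"
    by (rule eq_matI) (auto simp: scalar_prod_def unit_mode_orthonormal atLeast0LessThan)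
  then have "?B * ?A = 1\<^sub>m n"
    by (rule mat_mult_left_right_inverse[rotated 2]) auto
  then have "(?B * ?A) $$ (i, j) = (if i = j then 1 else 0)"
    using assms by simp
  moreover have "(?B * ?A) $$ (i, j) = (\<Sum>k<n. unit_mode n (Suc k) i * unit_mode n (Suc k) j)"
    using assms by (simp add: scalar_prod_def atLeast0LessThan)
  moreover have "(\<Sum>k<n. unit_mode n (Suc k) i * unit_mode n (Suc k) j) = (\<Sum>k=1..n. unit_mode n k i * unit_mode n k j)"
    by (rule sum.reindex_bij_witness[of _ "\<lambda>k. k - 1" Suc]) auto
  ultimately show ?thesis by simp
qed

abbreviation up :: "nat \<Rightarrow> nat \<Rightarrow> fock \<Rightarrow> fock" where
  "up n k \<equiv> raise_vec n (unit_mode n k)"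

abbreviation down :: "nat \<Rightarrow> nat \<Rightarrow> fock \<Rightarrow> fock" where
  "down n k \<equiv> lower_vec n (unit_mode n k)"

lemma up_down:
  "k \<in> {1..n} \<Longrightarrow> l \<in> {1..n} \<Longrightarrow> up n k (down n l f) + down n l (up n k f) = (if k = l then f else 0)"
  by (simp add: raise_vec_lower_vec unit_mode_orthonormal)

lemma transfer_up:
  assumes "k \<in> {1..n}"
  shows "transfer n (up n k f) = mode_ev n k *\<^sub>R down n (n + 1 - k) (transfer n f)"
proof -
  let ?a = "mode_inner n k k" and ?b = "mode_inner n (n + 1 - k) (n + 1 - k)"
  have k: "k \<le> n" and b: "sqrt ?b > 0" using assms by (auto intro!: mode_inner_pos)
  have "1 / sqrt ?a * (mode_ev n k)\<^sup>2 = mode_ev n k * (1 / sqrt ?b)"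
    unfolding sqrt_mode_inner_mirror[OF assms] using mode_ev_pos[of n k] b
    by (simp add: power2_eq_square field_simps)
  then show ?thesis
    unfolding unit_mode_def raise_vec_scale lower_vec_scale
    by (simp add: fock_op_simps[OF fock_op_transfer] transfer_raise_mode[OF k])
qed

lemma transfer_down:
  assumes "k \<in> {1..n}"
  shows "transfer n (down n k f) = inverse (mode_ev n k) *\<^sub>R up n (n + 1 - k) (transfer n f)"
proof -
  let ?a = "mode_inner n k k" and ?b = "mode_inner n (n + 1 - k) (n + 1 - k)"
  have k: "k \<le> n" and b: "sqrt ?b > 0" using assms by (auto intro!: mode_inner_pos)
  have "1 / sqrt ?a = inverse (mode_ev n k) * (1 / sqrt ?b)"
    unfolding sqrt_mode_inner_mirror[OF assms] using mode_ev_pos[of n k] b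
    by (simp add: field_simps)
  then show ?thesis
    unfolding unit_mode_def raise_vec_scale lower_vec_scale
    by (simp add: fock_op_simps[OF fock_op_transfer] transfer_lower_mode[OF k])
qed

text \<open>By completeness, a linear operator that vanishes on the images of all
  \<open>up n k\<close> vanishes on the images of all \<open>raise j\<close>.\<close>

lemma raise_expand:
  assumes "j < n"
  shows "raise j f = site_sign j *\<^sub>R (\<Sum>k=1..n. unit_mode n k j *\<^sub>R up n k f)"
proof -
  have "(\<Sum>k=1..n. unit_mode n k j *\<^sub>R up n k f) =
      (\<Sum>k=1..n. \<Sum>i<n. (unit_mode n k j * (site_sign i * unit_mode n k i)) *\<^sub>R raise i f)"
    by (simp add: raise_vec_def scaleR_sum_right)
  also have "\<dots> = (\<Sum>i<n. \<Sum>k=1..n. (unit_mode n k j * (site_sign i * unit_mode n k i)) *\<^sub>R raise i f)"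
    by (rule sum.swap)
  also have "\<dots> = (\<Sum>i<n. (site_sign i * (\<Sum>k=1..n. unit_mode n k j * unit_mode n k i)) *\<^sub>R raise i f)"
    unfolding sum_distrib_left by (simp add: scaleR_sum_left mult_ac)
  also have "\<dots> = (\<Sum>i<n. if j = i then site_sign i *\<^sub>R raise i f else 0)"
    using assms by (intro sum.cong) (auto simp: unit_mode_complete[simplified])
  also have "\<dots> = site_sign j *\<^sub>R raise j f"
    using assms by (simp add: sum.delta')
  finally show ?thesis by simp
qed

lemma lower_expand:
  assumes "j < n"
  shows "lower j f = site_sign j *\<^sub>R (\<Sum>k=1..n. unit_mode n k j *\<^sub>R down n k f)"
proof -
  have "(\<Sum>k=1..n. unit_mode n k j *\<^sub>R down n k f) =
      (\<Sum>k=1..n. \<Sum>i<n. (unit_mode n k j * (site_sign i * unit_mode n k i)) *\<^sub>R lower i f)"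
    by (simp add: lower_vec_def scaleR_sum_right)
  also have "\<dots> = (\<Sum>i<n. \<Sum>k=1..n. (unit_mode n k j * (site_sign i * unit_mode n k i)) *\<^sub>R lower i f)"
    by (rule sum.swap)
  also have "\<dots> = (\<Sum>i<n. (site_sign i * (\<Sum>k=1..n. unit_mode n k j * unit_mode n k i)) *\<^sub>R lower i f)"
    unfolding sum_distrib_left by (simp add: scaleR_sum_left mult_ac)
  also have "\<dots> = (\<Sum>i<n. if j = i then site_sign i *\<^sub>R lower i f else 0)"
    using assms by (intro sum.cong) (auto simp: unit_mode_complete[simplified])
  also have "\<dots> = site_sign j *\<^sub>R lower j f"
    using assms by (simp add: sum.delta')
  finally show ?thesis by simp
qed

section \<open>Traces of powers of the transfer operator\<close>

lemma up_up: "up n k (up n l f) = - up n l (up n k f)"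
  by (rule raise_vec_raise_vec)

lemma down_down: "down n k (down n l f) = - down n l (down n k f)"
  by (rule lower_vec_lower_vec)

lemma down_up:
  "k \<in> {1..n} \<Longrightarrow> l \<in> {1..n} \<Longrightarrow> down n k (up n l f) = (if k = l then f else 0) - up n l (down n k f)"
  using up_down[of l n k f] by (auto simp: algebra_simps)

lemma up_up_same [simp]: "up n k (up n k f) = 0"
  using up_up[of n k k f] by (simp add: fun_eq_iff)

lemma down_down_same [simp]: "down n k (down n k f) = 0"
  using down_down[of n k k f] by (simp add: fun_eq_iff)

lemmas up_simps = fock_op_simps[OF fock_op_raise_vec]
lemmas down_simps = fock_op_simps[OF fock_op_lower_vec]
lemmas transfer_simps = fock_op_simps[OF fock_op_transfer]

text \<open>\<open>up\<close> and \<open>down\<close> alternate between \<open>k\<close> and its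
  mirror image. Since \<open>mode_ev\<close> there is the inverse, the step back contributes the
  same factor again, and the factors accumulate to a power.\<close>

lemma transfer_pow_modes:
  assumes "k \<in> {1..n}"
  shows "(transfer n ^^ m) (up n k f) = mode_ev n k ^ m *\<^sub>R
      (if even m then up n k ((transfer n ^^ m) f) else down n (n + 1 - k) ((transfer n ^^ m) f))"
    and "(transfer n ^^ m) (down n k f) = inverse (mode_ev n k) ^ m *\<^sub>R
      (if even m then down n k ((transfer n ^^ m) f) else up n (n + 1 - k) ((transfer n ^^ m) f))"
proof -
  have k': "n + 1 - k \<in> {1..n}" and kk: "n + 1 - (n + 1 - k) = k" and k: "k \<le> n"
    using assms by auto
  note ev' = mode_ev_mirror[OF k]
  show "(transfer n ^^ m) (up n k f) = mode_ev n k ^ m *\<^sub>R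
      (if even m then up n k ((transfer n ^^ m) f) else down n (n + 1 - k) ((transfer n ^^ m) f))"
  proof (induction m)
    case (Suc m)
    show ?case
      unfolding funpow.simps comp_apply Suc transfer_simps(4)
      using transfer_up[OF assms] transfer_down[OF k', unfolded kk]
      by (simp add: ev'[simplified] del: scaleR_fun_apply)
  qed simp
  show "(transfer n ^^ m) (down n k f) = inverse (mode_ev n k) ^ m *\<^sub>R
      (if even m then down n k ((transfer n ^^ m) f) else up n (n + 1 - k) ((transfer n ^^ m) f))"
  proof (induction m)
    case (Suc m)
    show ?case
      unfolding funpow.simps comp_apply Suc transfer_simps(4)
      using transfer_down[OF assms] transfer_up[OF k', unfolded kk]
      by (simp add: ev'[simplified] del: scaleR_fun_apply)
  qed simp
qed

section \<open>The common kernels of the lowering and of the raising operators\<close>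

lemma transfer_pow_site_class:
  "(transfer n ^^ m) (basis (site_class n b)) = basis (site_class n (if even m then b else \<not> b))"
  by (induction m) (auto simp: transfer_site_class)

lemma lower_vec_odd_sites: "lower_vec n w (basis (site_class n False)) = 0"
  by (simp add: lower_vec_def lower_odd_sites)

text \<open>At a site \<open>j\<close> where \<open>S\<close> differs from the alternating state,
  \<open>raise j\<close> gives 0 and the anticommutator reduces to one term. So whatever kills the
  image of every \<open>raise j\<close> kills \<open>basis S\<close>.\<close>

lemma raise_lower_basis:
  assumes "S \<subseteq> {..<n}" "S \<noteq> site_class n False"
  obtains j where "j < n" "raise j (lower j (basis S)) = basis S"
proof -
  obtain j where j: "j < n" "j \<in> S \<longleftrightarrow> even j"
    using assms by (auto simp: site_class_def set_eq_iff)
  then have "raise j (basis S) = 0"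
    by (auto simp: raise_def cre_basis ann_basis)
  then have "raise j (lower j (basis S)) = basis S"
    using raise_lower[of j j "basis S"] fock_op_simps(5)[OF fock_op_lower[OF j(1)]] by simp
  then show thesis using j that by blast
qed

lemma lower_raise_basis:
  assumes "S \<subseteq> {..<n}" "S \<noteq> site_class n True"
  obtains j where "j < n" "lower j (raise j (basis S)) = basis S"
proof -
  obtain j where j: "j < n" "j \<in> S \<longleftrightarrow> odd j"
    using assms by (auto simp: site_class_def set_eq_iff)
  then have "lower j (basis S) = 0"
    by (auto simp: lower_def cre_basis ann_basis)
  then have "lower j (raise j (basis S)) = basis S"
    using raise_lower[of j j "basis S"] fock_op_simps(5)[OF fock_op_raise[OF j(1)]] by simp
  then show thesis using j that by blast
qed

text \<open>Every other \<open>S\<close> differs from the odd sites at some \<open>j\<close>; the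
  value of \<open>lower j f\<close> at \<open>S\<close> with \<open>j\<close> flipped is
  \<open>f S\<close> up to sign.\<close>

lemma lowered_to_zero:
  assumes "supported n f" "\<And>j. j < n \<Longrightarrow> lower j f = 0"
  shows "f = f (site_class n False) *\<^sub>R basis (site_class n False)"
proof (rule ext)
  fix S
  have "f S = 0" if S: "S \<noteq> site_class n False"
  proof (cases "S \<subseteq> {..<n}")
    case True
    then obtain j where j: "j < n" "j \<in> S \<longleftrightarrow> even j"
      using S by (auto simp: site_class_def set_eq_iff)
    show ?thesis
    proof (cases "even j")
      case True
      then have "ann j f (S - {j}) = 0" using assms(2)[OF j(1)] by (simp add: lower_def)
      then show ?thesis using True j by (simp add: ann_def insert_absorb sgn_below_def)
    next
      case False
      then have "cre j f (insert j S) = 0" using assms(2)[OF j(1)] by (simp add: lower_def)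
      then show ?thesis using False j by (simp add: cre_def sgn_below_def)
    qed
  qed (use assms(1) in \<open>simp add: supported_def\<close>)
  then show "f S = (f (site_class n False) *\<^sub>R basis (site_class n False)) S"
    by (auto simp: basis_def)
qed

text \<open>For \<open>k = n\<close> this is the projection onto the line of \<open>basis (site_class n False)\<close>, the common kernel of all
  lowering operators.\<close>

primrec vacuum_proj :: "nat \<Rightarrow> nat \<Rightarrow> fock \<Rightarrow> fock" where
  "vacuum_proj n 0 = (\<lambda>f. f)"
| "vacuum_proj n (Suc k) = (\<lambda>f. vacuum_proj n k (down n (Suc k) (up n (Suc k) f)))"

section \<open>Even powers: peeling off single modes\<close>

lemma fock_op_vacuum_proj: "fock_op n (vacuum_proj n k)"
  by (induction k)
    (simp_all add: fock_op_id fock_op_comp[of n "vacuum_proj n _", OF _ fock_op_comp[OF fock_op_lower_vec fock_op_raise_vec]])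

text \<open>The two operators of another mode give two signs, which cancel.\<close>

lemma vacuum_proj_up_commute:
  assumes "k < l" "l \<le> n"
  shows "vacuum_proj n k (up n l f) = up n l (vacuum_proj n k f)"
  using assms
proof (induction k arbitrary: f)
  case (Suc k)
  have "down n (Suc k) (up n (Suc k) (up n l f)) = up n l (down n (Suc k) (up n (Suc k) f))"
    using Suc.prems by (simp add: up_up[of n "Suc k" l] down_up down_simps)
  then show ?case using Suc by simp
qed simp

lemma vacuum_proj_up_zero:
  assumes "l \<in> {1..k}" "k \<le> n"
  shows "vacuum_proj n k (up n l f) = 0"
  using assms
proof (induction k arbitrary: f)
  case (Suc k)
  show ?case
  proof (cases "l = Suc k")
    case True
    then show ?thesis by (simp add: down_simps fock_op_simps[OF fock_op_vacuum_proj])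
  next
    case False
    have "down n (Suc k) (up n (Suc k) (up n l f)) = up n l (down n (Suc k) (up n (Suc k) f))"
      using Suc.prems False by (simp add: up_up[of n "Suc k" l] down_up down_simps)
    then show ?thesis using Suc False by simp
  qed
qed simp

lemma vacuum_proj_odd_sites:
  "k \<le> n \<Longrightarrow> vacuum_proj n k (basis (site_class n False)) = basis (site_class n False)"
  by (induction k) (simp_all add: down_up lower_vec_odd_sites up_simps)

lemma vacuum_proj_basis:
  assumes "S \<subseteq> {..<n}" "S \<noteq> site_class n False"
  shows "vacuum_proj n n (basis S) = 0"
proof -
  obtain j where j: "j < n" "raise j (lower j (basis S)) = basis S"
    using raise_lower_basis[OF assms] .
  have "vacuum_proj n n (raise j f) = 0" for f
    unfolding raise_expand[OF j(1)] fock_op_simps[OF fock_op_vacuum_proj]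
    by (simp add: vacuum_proj_up_zero)
  then show ?thesis using j(2) by metis
qed

text \<open>Iterates \<open>fock_trace_eigenmode\<close>: the factors of the modes already treated
  commute with the remaining \<open>up n l\<close>, which keep their eigenvalues.\<close>

lemma fock_trace_vacuum_proj:
  assumes "fock_op n Y" and Y: "\<And>l f. l \<in> {1..n} \<Longrightarrow> Y (up n l f) = w l *\<^sub>R up n l (Y f)"
    and "k \<le> n"
  shows "fock_trace n Y = (\<Prod>l=1..k. 1 + w l) * fock_trace n (\<lambda>f. Y (vacuum_proj n k f))"
  using \<open>k \<le> n\<close>
proof (induction k)
  case (Suc k)
  have k: "Suc k \<in> {1..n}" using Suc.prems by auto
  have "fock_trace n (\<lambda>f. Y (vacuum_proj n k f)) =
      (1 + w (Suc k)) * fock_trace n (\<lambda>f. Y (vacuum_proj n k (down n (Suc k) (up n (Suc k) f))))"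
  proof (rule fock_trace_eigenmode[where a = "up n (Suc k)" and b = "down n (Suc k)" and w = "w (Suc k)"
        and Y = "\<lambda>f. Y (vacuum_proj n k f)"])
    show "fock_op n (\<lambda>f. Y (vacuum_proj n k f))"
      by (rule fock_op_comp[OF assms(1) fock_op_vacuum_proj])
    show "up n (Suc k) (down n (Suc k) f) + down n (Suc k) (up n (Suc k) f) = f" for f
      using up_down[OF k k] by simp
    show "Y (vacuum_proj n k (up n (Suc k) f)) = w (Suc k) *\<^sub>R up n (Suc k) (Y (vacuum_proj n k f))" for f
      using k by (simp add: vacuum_proj_up_commute Y)
  qed (rule fock_op_raise_vec fock_op_lower_vec)+
  then show ?case using Suc by simp
qed simp

lemma fock_trace_single:
  assumes "R \<subseteq> {..<n}" "\<And>S. S \<subseteq> {..<n} \<Longrightarrow> S \<noteq> R \<Longrightarrow> X (basis S) = 0"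
  shows "fock_trace n X = X (basis R) R"
proof -
  have "fock_trace n X = (\<Sum>S\<in>Pow {..<n}. if S = R then X (basis R) R else 0)"
    unfolding fock_trace_def using assms by (intro sum.cong) auto
  then show ?thesis using assms(1) by (simp add: sum.delta)
qed

text \<open>Once all modes are peeled off only the odd-site state contributes, and an even power
  maps it to itself.\<close>

lemma fock_trace_transfer_even:
  assumes "even m"
  shows "fock_trace n (transfer n ^^ m) = (\<Prod>k=1..n. 1 + mode_ev n k ^ m)"
proof -
  let ?Y = "transfer n ^^ m" and ?Q = "site_class n False"
  have op: "fock_op n ?Y" by (rule fock_op_funpow[OF fock_op_transfer])
  have "fock_trace n ?Y = (\<Prod>l=1..n. 1 + mode_ev n l ^ m) * fock_trace n (\<lambda>f. ?Y (vacuum_proj n n f))"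
    using assms by (intro fock_trace_vacuum_proj[OF op]) (auto simp: transfer_pow_modes)
  also have "fock_trace n (\<lambda>f. ?Y (vacuum_proj n n f)) = ?Y (vacuum_proj n n (basis ?Q)) ?Q"
    by (intro fock_trace_single) (auto simp: site_class_def vacuum_proj_basis fock_op_simps[OF op])
  also have "\<dots> = 1"
    using assms by (simp add: vacuum_proj_odd_sites transfer_pow_site_class) (simp add: basis_def)
  finally show ?thesis by simp
qed

text \<open>The middle mode is its own mirror image, so its eigenvalue equals its inverse and is 1;
  an odd power then exchanges its \<open>up\<close> and \<open>down\<close>.\<close>

lemma fock_trace_transfer_odd_odd:
  assumes "odd m" "odd n"
  shows "fock_trace n (transfer n ^^ m) = 0"
proof -
  define k where "k = (n + 1) div 2"
  have k: "k \<in> {1..n}" "n + 1 - k = k" using assms by (auto simp: k_def elim!: oddE)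
  then have "mode_ev n k * mode_ev n k = 1"
    using mode_ev_mirror[of k n] mode_ev_pos[of n k] by (auto simp: field_simps)
  then have "mode_ev n k = 1"
    using mode_ev_pos[of n k] by (auto simp: square_eq_1_iff)
  then have "(transfer n ^^ m) (up n k f) = down n k ((transfer n ^^ m) f)"
    "(transfer n ^^ m) (down n k f) = up n k ((transfer n ^^ m) f)" for f
    using transfer_pow_modes[OF k(1), of m f] assms k(2) by auto
  then show ?thesis
    using up_down[OF k(1) k(1)]
    by (intro fock_trace_self_exchange[where a = "up n k" and a' = "down n k"])
      (auto intro: fock_op_funpow fock_op_transfer fock_op_raise_vec fock_op_lower_vec)
qed

text \<open>Here \<open>n - k\<close> is the mirror image \<open>n + 1 - Suc k\<close> of the mode \<open>Suc k\<close>.\<close>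

primrec lower_pairs :: "nat \<Rightarrow> nat \<Rightarrow> fock \<Rightarrow> fock" where
  "lower_pairs n 0 = (\<lambda>f. f)"
| "lower_pairs n (Suc k) = (\<lambda>f. lower_pairs n k (down n (Suc k) (down n (n - k) f)))"

text \<open>The order of the factors is the one in which the transfer operator turns those of
  \<open>lower_pairs\<close> into raising operators, so that \<open>transfer_lower_pairs\<close>
  carries no sign.\<close>

primrec raise_pairs :: "nat \<Rightarrow> nat \<Rightarrow> fock \<Rightarrow> fock" where
  "raise_pairs n 0 = (\<lambda>f. f)"
| "raise_pairs n (Suc k) = (\<lambda>f. raise_pairs n k (up n (n - k) (up n (Suc k) f)))"

section \<open>Odd powers: lowering mirror pairs of modes\<close>

lemma fock_op_lower_pairs: "fock_op n (lower_pairs n k)"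
  by (induction k)
    (simp_all add: fock_op_id fock_op_comp[of n "lower_pairs n _", OF _ fock_op_comp[OF fock_op_lower_vec fock_op_lower_vec]])

lemma lower_pairs_down: "lower_pairs n k (down n l f) = down n l (lower_pairs n k f)"
proof (induction k arbitrary: f)
  case (Suc k)
  have "down n (Suc k) (down n (n - k) (down n l f)) = down n l (down n (Suc k) (down n (n - k) f))"
    by (simp add: down_down[of n "n - k" l] down_down[of n "Suc k" l] down_simps)
  then show ?case using Suc by simp
qed simp

text \<open>The hypotheses keep \<open>l\<close> away from the modes 1, ..., k and n - k + 1, ..., n
  that \<open>lower_pairs\<close> involves.\<close>

lemma lower_pairs_up:
  assumes "k < l" "l + k \<le> n"
  shows "lower_pairs n k (up n l f) = up n l (lower_pairs n k f)"
  using assms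
proof (induction k arbitrary: f)
  case (Suc k)
  have "down n (Suc k) (down n (n - k) (up n l f)) = up n l (down n (Suc k) (down n (n - k) f))"
    using Suc.prems by (simp add: down_up down_simps)
  then show ?case using Suc by simp
qed simp

lemma raise_pairs_down:
  assumes "k < l" "l + k \<le> n"
  shows "raise_pairs n k (down n l f) = down n l (raise_pairs n k f)"
  using assms
proof (induction k arbitrary: f)
  case (Suc k)
  have "down n l (up n (n - k) (up n (Suc k) f)) = up n (n - k) (up n (Suc k) (down n l f))"
    using Suc.prems by (simp add: down_up up_simps)
  then show ?case using Suc by (metis (no_types, lifting) Suc_leD Suc_lessD add_Suc_right raise_pairs.simps(2))
qed simp

lemma lower_pairs_down_zero:
  assumes "l \<in> {1..k} \<union> {n - k<..n}"
  shows "lower_pairs n k (down n l f) = 0"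
  using assms
proof (induction k arbitrary: f)
  case (Suc k)
  have "l = Suc k \<or> l = n - k \<or> (1 \<le> l \<and> l \<le> k) \<or> (n - k < l \<and> l \<le> n)"
    using Suc.prems by simp linarith
  then consider "l = Suc k" | "l = n - k" | "l \<in> {1..k} \<union> {n - k<..n}"
    by fastforce
  then show ?case
  proof cases
    case 1
    then show ?thesis
      by (simp add: down_down[of n "n - k" "Suc k"] down_simps fock_op_simps[OF fock_op_lower_pairs])
  next
    case 2
    then show ?thesis by (simp add: down_simps fock_op_simps[OF fock_op_lower_pairs])
  next
    case 3
    have "down n (Suc k) (down n (n - k) (down n l f)) = down n l (down n (Suc k) (down n (n - k) f))"
      by (simp add: down_down[of n "n - k" l] down_down[of n "Suc k" l] down_simps)
    then show ?thesis using Suc.IH[OF 3] by simp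
  qed
qed simp

text \<open>The innermost pairs cancel first: the lowering operators pass the other raising pairs,
  meet their own partners, and otherwise reach a state that they kill.\<close>

lemma lower_pairs_raise_pairs:
  assumes "2 * k \<le> n"
  shows "lower_pairs n k (raise_pairs n k (basis (site_class n False))) = basis (site_class n False)"
  using assms
proof (induction k)
  case (Suc k)
  let ?Q = "basis (site_class n False)"
  have "down n (Suc k) (down n (n - k) (raise_pairs n k (up n (n - k) (up n (Suc k) ?Q))))
      = raise_pairs n k (down n (Suc k) (down n (n - k) (up n (n - k) (up n (Suc k) ?Q))))"
    using Suc.prems by (simp add: raise_pairs_down)
  also have "down n (Suc k) (down n (n - k) (up n (n - k) (up n (Suc k) ?Q))) = ?Q"
    using Suc.prems by (simp add: down_up lower_vec_odd_sites up_simps down_simps)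
  finally show ?case using Suc by simp
qed simp

text \<open>The scalars of a mode and of its mirror image are inverse to each other and
  cancel.\<close>

lemma transfer_lower_pairs:
  assumes "2 * k \<le> n"
  shows "transfer n (lower_pairs n k f) = raise_pairs n k (transfer n f)"
  using assms
proof (induction k arbitrary: f)
  case (Suc k)
  have k: "Suc k \<in> {1..n}" "n - k \<in> {1..n}" "n + 1 - Suc k = n - k" "n + 1 - (n - k) = Suc k" "Suc k \<le> n"
    using Suc.prems by auto
  have "mode_ev n (n - k) = inverse (mode_ev n (Suc k))"
    using mode_ev_mirror[OF k(5)] unfolding k(3) .
  then have "transfer n (down n (Suc k) (down n (n - k) f)) = up n (n - k) (up n (Suc k) (transfer n f))"
    unfolding transfer_down[OF k(1)] transfer_down[OF k(2)] k(3,4)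
    using mode_ev_pos[of n "Suc k"] by (simp add: up_simps)
  then show ?case using Suc by simp
qed simp

text \<open>Iterates \<open>fock_trace_exchange_pair\<close> with the modes \<open>Suc k\<close> and
  \<open>n - k\<close>, which do not occur in \<open>lower_pairs n k\<close>.\<close>

lemma fock_trace_lower_pairs:
  assumes "odd m" "2 * k \<le> n"
  shows "fock_trace n (transfer n ^^ m) = (\<Prod>l=1..k. mode_ev n l ^ m - inverse (mode_ev n l) ^ m)
    * fock_trace n (\<lambda>f. (transfer n ^^ m) (lower_pairs n k f))"
  using assms(2)
proof (induction k)
  case (Suc k)
  let ?Y = "transfer n ^^ m" and ?w = "mode_ev n (Suc k) ^ m" and ?v = "inverse (mode_ev n (Suc k)) ^ m"
  have k: "Suc k \<in> {1..n}" "n - k \<in> {1..n}" "n + 1 - Suc k = n - k" "n + 1 - (n - k) = Suc k" "Suc k \<le> n"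
    using Suc.prems by auto
  have ev: "mode_ev n (n - k) = inverse (mode_ev n (Suc k))"
    using mode_ev_mirror[OF k(5)] unfolding k(3) .
  have op: "fock_op n ?Y" by (rule fock_op_funpow[OF fock_op_transfer])
  note Y = transfer_pow_modes[OF k(1), of m, unfolded k(3)] transfer_pow_modes[OF k(2), of m, unfolded k(4) ev]
  have "fock_trace n (\<lambda>f. ?Y (lower_pairs n k f)) =
      (?w - ?v) * fock_trace n (\<lambda>f. ?Y (lower_pairs n k (down n (Suc k) (down n (n - k) f))))"
  proof (rule fock_trace_exchange_pair[where a = "up n (Suc k)" and b = "up n (n - k)"
        and a' = "down n (Suc k)" and b' = "down n (n - k)" and w = ?w and v = ?v
        and Y = "\<lambda>f. ?Y (lower_pairs n k f)"])
    show "fock_op n (\<lambda>f. ?Y (lower_pairs n k f))"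
      by (rule fock_op_comp[OF op fock_op_lower_pairs])
    show "up n (Suc k) (down n (Suc k) f) + down n (Suc k) (up n (Suc k) f) = f" for f
      using up_down[OF k(1,1)] by simp
    show "up n (n - k) (down n (n - k) f) + down n (n - k) (up n (n - k) f) = f" for f
      using up_down[OF k(2,2)] by simp
    show "down n (Suc k) (down n (n - k) f) = - down n (n - k) (down n (Suc k) f)" for f
      by (rule down_down)
    show "?v * ?w = 1" using mode_ev_pos[of n "Suc k"] by (simp flip: power_mult_distrib)
    show "?Y (lower_pairs n k (up n (Suc k) f)) = ?w *\<^sub>R down n (n - k) (?Y (lower_pairs n k f))"
      "?Y (lower_pairs n k (up n (n - k) f)) = ?v *\<^sub>R down n (Suc k) (?Y (lower_pairs n k f))"
      "?Y (lower_pairs n k (down n (Suc k) f)) = ?v *\<^sub>R up n (n - k) (?Y (lower_pairs n k f))" for f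
      using Suc.prems assms(1) by (simp_all add: lower_pairs_up lower_pairs_down Y)
  qed (rule fock_op_raise_vec fock_op_lower_vec)+
  then show ?case using Suc by simp
qed simp

text \<open>Lowering all modes sends the even-site state to plus or minus the odd-site state and
  kills every other basis state; an odd power leads back. So the remaining trace is a sign.\<close>

lemma fock_trace_transfer_odd_even:
  assumes "odd m" "n = 2 * r"
  shows "\<bar>fock_trace n (transfer n ^^ m)\<bar> =
    \<bar>\<Prod>l=1..r. mode_ev n l ^ m - inverse (mode_ev n l) ^ m\<bar>"
proof -
  let ?Y = "transfer n ^^ m" and ?P = "site_class n True" and ?Q = "site_class n False"
  let ?Z = "lower_pairs n r"
  have op: "fock_op n ?Y" by (rule fock_op_funpow[OF fock_op_transfer])
  have sub: "?P \<subseteq> {..<n}" "?Q \<subseteq> {..<n}" by (auto simp: site_class_def)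
  have "?Z (down n l f) = 0" if "l \<in> {1..n}" for l f
    using that assms(2) by (intro lower_pairs_down_zero) auto
  \<comment> \<open>\<open>lower j\<close> is a combination of the \<open>down n l\<close>, all of
    which occur in \<open>lower_pairs n r\<close>.\<close>
  then have "?Z (lower j f) = 0 \<and> lower j (?Z f) = 0" if "j < n" for j f
    unfolding lower_expand[OF that] fock_op_simps[OF fock_op_lower_pairs]
    by (simp add: lower_pairs_down[symmetric])
  then have Z0: "\<And>j f. j < n \<Longrightarrow> ?Z (lower j f) = 0" and Z0': "\<And>j f. j < n \<Longrightarrow> lower j (?Z f) = 0"
    by auto
  have Z: "?Z (basis S) = 0" if S: "S \<subseteq> {..<n}" "S \<noteq> ?P" for S
  proof -
    obtain j where "j < n" "lower j (raise j (basis S)) = basis S"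
      using lower_raise_basis[OF S] .
    then show ?thesis using Z0[of j "raise j (basis S)"] by simp
  qed
  \<comment> \<open>The transfer operator turns \<open>lower_pairs\<close> into \<open>raise_pairs\<close>, a one-sided inverse; this forces \<open>d\<^sup>2 = 1\<close>.\<close>
  define d where "d = ?Z (basis ?P) ?Q"
  have "supported n (?Z (basis ?P))"
    using fock_op_lower_pairs supported_basis[OF sub(1)] by (auto simp: fock_op_def)
  then have ZP: "?Z (basis ?P) = d *\<^sub>R basis ?Q"
    unfolding d_def using Z0' by (rule lowered_to_zero)
  have "raise_pairs n r (basis ?Q) = transfer n (?Z (basis ?P))"
    using transfer_lower_pairs[of r n "basis ?P"] assms(2) by (simp add: transfer_site_class)
  also have "\<dots> = d *\<^sub>R basis ?P"
    by (simp add: ZP transfer_simps transfer_site_class)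
  finally have "?Z (raise_pairs n r (basis ?Q)) = (d * d) *\<^sub>R basis ?Q"
    by (simp add: ZP fock_op_simps[OF fock_op_lower_pairs])
  then have "(d * d) *\<^sub>R basis ?Q = basis ?Q"
    using lower_pairs_raise_pairs[of r n] assms(2) by simp
  then have "(d * d) * basis ?Q ?Q = basis ?Q ?Q"
    by (metis scaleR_fun_apply real_scaleR_def)
  then have d: "\<bar>d\<bar> = 1"
    by (simp add: basis_def abs_square_eq_1 flip: power2_eq_square)
  have "fock_trace n (\<lambda>f. ?Y (?Z f)) = ?Y (?Z (basis ?P)) ?P"
    using Z sub by (intro fock_trace_single) (auto simp: fock_op_simps[OF op])
  also have "\<dots> = d"
    using assms(1) by (simp add: ZP fock_op_simps[OF op] transfer_pow_site_class) (simp add: basis_def)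
  finally show ?thesis
    using fock_trace_lower_pairs[OF assms(1), of r n] assms(2) d by (simp add: abs_mult)
qed

section \<open>Perfect matchings as closed walks\<close>

text \<open>A dimer is represented by its lower end \<open>j\<close>; it covers \<open>j\<close> and \<open>j + 1\<close>.\<close>

definition covered :: "nat set \<Rightarrow> nat set" where
  "covered D = D \<union> Suc ` D"

definition dimer_sets :: "nat \<Rightarrow> nat set \<Rightarrow> nat set set" where
  "dimer_sets i S = {D. D \<subseteq> {..<i} \<and> (\<forall>j\<in>D. Suc j \<notin> D) \<and> S \<inter> covered D = {}}"

section \<open>Dimers in one column\<close>

lemma finite_dimer_sets: "finite (dimer_sets i S)"
  by (rule finite_subset[of _ "Pow {..<i}"]) (auto simp: dimer_sets_def)

text \<open>The signs of two adjacent sites cancel, so every dimer counts with weight +1.\<close>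

lemma ann_Suc_ann: "ann (Suc i) (ann i f) S = (if i \<in> S \<or> Suc i \<in> S then 0 else f (insert i (insert (Suc i) S)))"
proof -
  have "sgn_below (Suc i) S = sgn_below i S" if "i \<notin> S"
  proof -
    have "{k \<in> S. k < Suc i} = {k \<in> S. k < i}" using that by (auto simp: less_Suc_eq)
    then show ?thesis by (simp add: sgn_below_def)
  qed
  then show ?thesis by (auto simp: ann_def sgn_below_insert)
qed

text \<open>Split by whether the topmost dimer is used. If so, its ends join the occupied sites,
  which also rules out a dimer with lower end \<open>i - 1\<close>.\<close>

lemma dimer_sets_Suc:
  "dimer_sets (Suc i) S = dimer_sets i S \<union>
    (if i \<in> S \<or> Suc i \<in> S then {} else insert i ` dimer_sets i (insert i (insert (Suc i) S)))"
    (is "?L = ?A \<union> ?B")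
proof (rule Set.set_eqI)
  fix D
  show "D \<in> ?L \<longleftrightarrow> D \<in> ?A \<union> ?B"
  proof (cases "i \<in> D")
    case False
    then have "D \<subseteq> {..<Suc i} \<longleftrightarrow> D \<subseteq> {..<i}" by (auto simp: less_Suc_eq)
    moreover have "D \<notin> ?B" using False by auto
    ultimately show ?thesis by (simp add: dimer_sets_def)
  next
    case True
    have A: "D \<notin> ?A" using True by (auto simp: dimer_sets_def)
    show ?thesis
    proof
      assume L: "D \<in> ?L"
      then have D: "D \<subseteq> {..<Suc i}" "\<forall>j\<in>D. Suc j \<notin> D" "S \<inter> covered D = {}"
        by (auto simp: dimer_sets_def)
      then have S: "i \<notin> S" "Suc i \<notin> S" using True by (auto simp: covered_def)
      have "D - {i} \<in> dimer_sets i (insert i (insert (Suc i) S))"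
        using D True by (auto simp: dimer_sets_def covered_def less_Suc_eq)
      then have "insert i (D - {i}) \<in> insert i ` dimer_sets i (insert i (insert (Suc i) S))"
        by (rule imageI)
      then have "D \<in> insert i ` dimer_sets i (insert i (insert (Suc i) S))"
        using True by (simp add: insert_absorb)
      then show "D \<in> ?A \<union> ?B" using S by simp
    next
      assume "D \<in> ?A \<union> ?B"
      then obtain D' where D': "D = insert i D'" "D' \<in> dimer_sets i (insert i (insert (Suc i) S))"
        and S: "i \<notin> S" "Suc i \<notin> S"
        using A by (auto split: if_splits)
      have "D' \<subseteq> {..<i}" "\<forall>j\<in>D'. Suc j \<notin> D'" "insert i (insert (Suc i) S) \<inter> covered D' = {}"
        using D'(2) by (auto simp: dimer_sets_def)
      then show "D \<in> ?L"
        using S unfolding D'(1) dimer_sets_def covered_def by (auto simp: less_Suc_eq)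
    qed
  qed
qed

lemma dimers_apply: "dimers i f S = (\<Sum>D\<in>dimer_sets i S. f (S \<union> covered D))"
proof (induction i arbitrary: S)
  case 0
  have "dimer_sets 0 S = {{}}" by (auto simp: dimer_sets_def covered_def)
  then show ?case by (simp add: covered_def dimers.simps)
next
  case (Suc i)
  show ?case
  proof (cases "i \<in> S \<or> Suc i \<in> S")
    case True
    then show ?thesis using Suc by (simp add: dimers.simps ann_Suc_ann dimer_sets_Suc)
  next
    case False
    let ?S = "insert i (insert (Suc i) S)"
    have out: "i \<notin> D" if "D \<in> dimer_sets i R" for D R
      using that by (auto simp: dimer_sets_def)
    have "(\<Sum>D\<in>insert i ` dimer_sets i ?S. f (S \<union> covered D)) = (\<Sum>D\<in>dimer_sets i ?S. f (S \<union> covered (insert i D)))"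
      by (subst sum.reindex) (auto intro!: inj_onI dest: insert_ident[OF out out, THEN iffD1])
    also have "\<dots> = (\<Sum>D\<in>dimer_sets i ?S. f (?S \<union> covered D))"
      by (intro sum.cong refl arg_cong[where f = f]) (auto simp: covered_def)
    finally have *: "(\<Sum>D\<in>insert i ` dimer_sets i ?S. f (S \<union> covered D)) = dimers i f ?S"
      using Suc by simp
    have "dimer_sets i S \<inter> insert i ` dimer_sets i ?S = {}"
      using out by auto
    then have "(\<Sum>D\<in>dimer_sets (Suc i) S. f (S \<union> covered D)) = dimers i f S + dimers i f ?S"
      using False Suc[of S] * by (simp add: dimer_sets_Suc sum.union_disjoint finite_dimer_sets)
    then show ?thesis using False by (simp add: dimers.simps ann_Suc_ann)
  qed
qed

text \<open>The sites left uncovered are matched by edges into the next column.\<close>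

definition next_row :: "nat \<Rightarrow> nat set \<Rightarrow> nat set \<Rightarrow> nat set" where
  "next_row n S D = {..<n} - (S \<union> covered D)"

lemma transfer_apply:
  assumes "S \<subseteq> {..<n}"
  shows "transfer n f S = (\<Sum>D\<in>dimer_sets (n - 1) S. f (next_row n S D))"
  unfolding transfer_def dimers_apply
proof (rule sum.cong[OF refl])
  fix D assume "D \<in> dimer_sets (n - 1) S"
  then have "D \<subseteq> {..<n - 1}" by (simp add: dimer_sets_def)
  then have "covered D \<subseteq> {..<n}" by (fastforce simp: covered_def)
  then show "complement n f (S \<union> covered D) = f (next_row n S D)"
    using assms by (simp add: complement_def next_row_def)
qed

section \<open>Closed walks and the trace\<close>

primrec walk_end :: "nat \<Rightarrow> nat set \<Rightarrow> nat set list \<Rightarrow> nat set" where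
  "walk_end n S [] = S"
| "walk_end n S (D # Ds) = walk_end n (next_row n S D) Ds"

primrec valid_walk :: "nat \<Rightarrow> nat set \<Rightarrow> nat set list \<Rightarrow> bool" where
  "valid_walk n S [] \<longleftrightarrow> True"
| "valid_walk n S (D # Ds) \<longleftrightarrow> D \<in> dimer_sets (n - 1) S \<and> valid_walk n (next_row n S D) Ds"

definition walks :: "nat \<Rightarrow> nat \<Rightarrow> nat set \<Rightarrow> nat set list set" where
  "walks n m S = {Ds. length Ds = m \<and> valid_walk n S Ds}"

lemma walks_0: "walks n 0 S = {[]}"
  by (auto simp: walks_def)

lemma walks_Suc:
  "walks n (Suc m) S =
    (\<lambda>(D, Ds). D # Ds) ` (SIGMA D:dimer_sets (n - 1) S. walks n m (next_row n S D))"
  by (auto simp: walks_def length_Suc_conv image_iff)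

lemma finite_walks: "finite (walks n m S)"
  by (induction m arbitrary: S) (auto simp: walks_0 walks_Suc finite_dimer_sets)

lemma next_row_subset: "next_row n S D \<subseteq> {..<n}"
  by (auto simp: next_row_def)

lemma transfer_pow_apply:
  assumes "S \<subseteq> {..<n}"
  shows "(transfer n ^^ m) f S = (\<Sum>Ds\<in>walks n m S. f (walk_end n S Ds))"
  using assms
proof (induction m arbitrary: S)
  case 0
  show ?case by (simp add: walks_0)
next
  case (Suc m)
  have "(transfer n ^^ Suc m) f S =
      (\<Sum>D\<in>dimer_sets (n - 1) S. \<Sum>Ds\<in>walks n m (next_row n S D). f (walk_end n (next_row n S D) Ds))"
    using Suc by (simp add: transfer_apply next_row_subset)
  also have "\<dots> = (\<Sum>(D, Ds)\<in>(SIGMA D:dimer_sets (n - 1) S. walks n m (next_row n S D)).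
      f (walk_end n S (D # Ds)))"
    by (subst sum.Sigma) (auto simp: finite_dimer_sets finite_walks)
  also have "\<dots> = (\<Sum>Ds\<in>walks n (Suc m) S. f (walk_end n S Ds))"
    unfolding walks_Suc by (subst sum.reindex) (auto intro!: inj_onI sum.cong)
  finally show ?case .
qed

definition closed_walks :: "nat \<Rightarrow> nat \<Rightarrow> (nat set \<times> nat set list) set" where
  "closed_walks n m = {(S, Ds). S \<subseteq> {..<n} \<and> Ds \<in> walks n m S \<and> walk_end n S Ds = S}"

lemma fock_trace_transfer_pow: "fock_trace n (transfer n ^^ m) = real (card (closed_walks n m))"
proof -
  have "fock_trace n (transfer n ^^ m) =
      (\<Sum>S\<in>Pow {..<n}. \<Sum>Ds\<in>walks n m S. basis S (walk_end n S Ds))"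
    unfolding fock_trace_def by (intro sum.cong) (auto simp: transfer_pow_apply)
  also have "\<dots> = (\<Sum>S\<in>Pow {..<n}. real (card {Ds \<in> walks n m S. walk_end n S Ds = S}))"
    by (simp add: basis_def sum.If_cases finite_walks Int_def)
  also have "\<dots> = real (card (SIGMA S:Pow {..<n}. {Ds \<in> walks n m S. walk_end n S Ds = S}))"
    by (subst card_SigmaI) (auto simp: finite_walks)
  also have "(SIGMA S:Pow {..<n}. {Ds \<in> walks n m S. walk_end n S Ds = S}) = closed_walks n m"
    by (auto simp: closed_walks_def)
  finally show ?thesis .
qed

lemma valid_walk_map:
  assumes "\<And>i. i < m \<Longrightarrow> D i \<in> dimer_sets (n - 1) (H i) \<and> H (Suc i) = next_row n (H i) (D i)"
  shows "valid_walk n (H 0) (map D [0..<m]) \<and> walk_end n (H 0) (map D [0..<m]) = H m"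
  using assms
proof (induction m arbitrary: H D)
  case (Suc m)
  have "map D [0..<Suc m] = D 0 # map (\<lambda>i. D (Suc i)) [0..<m]"
    by (simp add: upt_conv_Cons map_Suc_upt[symmetric] del: upt_Suc)
  moreover have "valid_walk n (H (Suc 0)) (map (\<lambda>i. D (Suc i)) [0..<m]) \<and>
      walk_end n (H (Suc 0)) (map (\<lambda>i. D (Suc i)) [0..<m]) = H (Suc m)"
    by (rule Suc.IH) (rule Suc.prems, simp)
  ultimately show ?case using Suc.prems[of 0] by simp
qed simp

lemma valid_walk_nth:
  assumes "valid_walk n S Ds" "i < length Ds"
  shows "Ds ! i \<in> dimer_sets (n - 1) (walk_end n S (take i Ds))"
    and "walk_end n S (take (Suc i) Ds) = next_row n (walk_end n S (take i Ds)) (Ds ! i)"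
  using assms by (induction Ds arbitrary: S i) (auto simp: nth_Cons split: nat.splits)

lemma walk_end_subset: "S \<subseteq> {..<n} \<Longrightarrow> walk_end n S Ds \<subseteq> {..<n}"
  by (induction Ds arbitrary: S) (auto simp: next_row_subset)

text \<open>The horizontal edge in row \<open>j\<close> from column \<open>i - 1\<close> to column \<open>i\<close>, with column \<open>m\<close> identified with column \<open>0\<close>.\<close>

definition hedge :: "nat \<Rightarrow> nat \<Rightarrow> nat \<Rightarrow> cylinder_edge" where
  "hedge m i j = (if i mod m = 0 then Wrap (int j) else Grid {(int i - 1, int j), (int i, int j)})"

definition vedge :: "nat \<Rightarrow> nat \<Rightarrow> cylinder_edge" where
  "vedge i j = Grid {(int i, int j), (int i, int j + 1)}"

section \<open>Edges of the cylinder\<close>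

lemma hedge_eq_iff:
  "i < m \<Longrightarrow> i' < m \<Longrightarrow> hedge m i j = hedge m i' j' \<longleftrightarrow> i = i' \<and> j = j'"
  by (auto simp: hedge_def doubleton_eq_iff)

lemma vedge_eq_iff: "vedge i j = vedge i' j' \<longleftrightarrow> i = i' \<and> j = j'"
  by (auto simp: vedge_def doubleton_eq_iff)

lemma hedge_neq_vedge: "hedge m i j \<noteq> vedge i' j'"
  by (auto simp: hedge_def vedge_def doubleton_eq_iff)

lemma dist_int_pair_eq_1:
  "dist (real_of_int a, real_of_int b) (real_of_int c, real_of_int d) = 1 \<longleftrightarrow> (a = c \<and> \<bar>b - d\<bar> = 1) \<or> (b = d \<and> \<bar>a - c\<bar> = 1)"
  for a b c d :: int
proof -
  have sq: "x\<^sup>2 + y\<^sup>2 = 1 \<longleftrightarrow> (x = 0 \<and> \<bar>y\<bar> = 1) \<or> (y = 0 \<and> \<bar>x\<bar> = 1)" for x y :: int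
  proof
    assume *: "x\<^sup>2 + y\<^sup>2 = 1"
    have "x = 0 \<or> y = 0"
    proof (rule ccontr)
      assume "\<not> (x = 0 \<or> y = 0)"
      then have "x\<^sup>2 > 0" "y\<^sup>2 > 0" by auto
      then show False using * by linarith
    qed
    then show "(x = 0 \<and> \<bar>y\<bar> = 1) \<or> (y = 0 \<and> \<bar>x\<bar> = 1)"
      using * by (auto simp: power2_eq_1_iff)
  next
    assume "(x = 0 \<and> \<bar>y\<bar> = 1) \<or> (y = 0 \<and> \<bar>x\<bar> = 1)"
    then show "x\<^sup>2 + y\<^sup>2 = 1" by (auto simp: abs_if split: if_splits)
  qed
  have "dist (real_of_int a, real_of_int b) (real_of_int c, real_of_int d) = 1 \<longleftrightarrow> (real_of_int a - real_of_int c)\<^sup>2 + (real_of_int b - real_of_int d)\<^sup>2 = 1"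
    by (simp add: dist_Pair_Pair dist_real_def)
  also have "\<dots> \<longleftrightarrow> real_of_int ((a - c)\<^sup>2 + (b - d)\<^sup>2) = real_of_int 1"
    by simp
  also have "\<dots> \<longleftrightarrow> (a - c)\<^sup>2 + (b - d)\<^sup>2 = 1"
    by (rule of_int_eq_iff)
  also have "\<dots> \<longleftrightarrow> (a = c \<and> \<bar>b - d\<bar> = 1) \<or> (b = d \<and> \<bar>a - c\<bar> = 1)"
    unfolding sq by auto
  finally show ?thesis .
qed

text \<open>Vertical edges are indexed by the lower end and horizontal ones by the right end, as in
  \<open>vedge\<close> and \<open>hedge\<close>; \<open>0 < i\<close> leaves column 0 to the added
  edges.\<close>

lemma grid_edges_eq:
  "grid_edges m n = {{(int i, int j), (int i, int j + 1)} | i j. i < m \<and> Suc j < n} \<union>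
     {{(int i - 1, int j), (int i, int j)} | i j. 0 < i \<and> i < m \<and> j < n}" (is "_ = ?V \<union> ?H")
proof (intro equalityI subsetI)
  fix e assume "e \<in> grid_edges m n"
  then obtain a b c d where e: "e = {(a, b), (c, d)}"
    and r: "0 \<le> a" "a < int m" "0 \<le> b" "b < int n" "0 \<le> c" "c < int m" "0 \<le> d" "d < int n"
    and "dist (real_of_int a, real_of_int b) (real_of_int c, real_of_int d) = 1"
    by (auto simp: grid_edges_def grid_verts_def)
  then consider "a = c" "d = b + 1" | "a = c" "b = d + 1" | "b = d" "c = a + 1" | "b = d" "a = c + 1"
    unfolding dist_int_pair_eq_1 by linarith
  then show "e \<in> ?V \<union> ?H"
  proof cases
    case 1
    then have "e = {(int (nat a), int (nat b)), (int (nat a), int (nat b) + 1)}" "nat a < m" "Suc (nat b) < n"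
      using e r by auto
    then show ?thesis by blast
  next
    case 2
    then have "e = {(int (nat a), int (nat d)), (int (nat a), int (nat d) + 1)}" "nat a < m" "Suc (nat d) < n"
      using e r by auto
    then show ?thesis by blast
  next
    case 3
    then have "e = {(int (nat c) - 1, int (nat b)), (int (nat c), int (nat b))}" "0 < nat c" "nat c < m" "nat b < n"
      using e r by auto
    then show ?thesis by blast
  next
    case 4
    then have "e = {(int (nat a) - 1, int (nat b)), (int (nat a), int (nat b))}" "0 < nat a" "nat a < m" "nat b < n"
      using e r by auto
    then show ?thesis by blast
  qed
next
  fix e assume "e \<in> ?V \<union> ?H"
  then show "e \<in> grid_edges m n"
  proof
    assume "e \<in> ?V"
    then obtain i j where "e = {(int i, int j), (int i, int j + 1)}" "i < m" "Suc j < n" by auto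
    then show ?thesis
      using dist_int_pair_eq_1[of "int i" "int j" "int i" "int j + 1"]
      unfolding grid_edges_def grid_verts_def
      by - (rule CollectI, rule exI[of _ "(int i, int j)"], rule exI[of _ "(int i, int j + 1)"],
        auto)
  next
    assume "e \<in> ?H"
    then obtain i j where "e = {(int i - 1, int j), (int i, int j)}" "0 < i" "i < m" "j < n" by auto
    then show ?thesis
      using dist_int_pair_eq_1[of "int i - 1" "int j" "int i" "int j"]
      unfolding grid_edges_def grid_verts_def
      by - (rule CollectI, rule exI[of _ "(int i - 1, int j)"], rule exI[of _ "(int i, int j)"],
        auto)
  qed
qed

lemma edges_cylinder_graph:
  assumes "m \<ge> 1"
  shows "edges (cylinder_graph m n) =
    {hedge m i j | i j. i < m \<and> j < n} \<union> {vedge i j | i j. i < m \<and> Suc j < n}"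
proof -
  have "Wrap ` {0..int n - 1} = {Wrap (int j) | j. j < n}"
  proof -
    have "{0..int n - 1} = int ` {..<n}"
      by (auto simp: image_iff intro!: bexI[of _ "nat _"])
    then show ?thesis by auto
  qed
  moreover have "{hedge m i j | i j. i < m \<and> j < n} =
      {Wrap (int j) | j. j < n} \<union> Grid ` {{(int i - 1, int j), (int i, int j)} | i j. 0 < i \<and> i < m \<and> j < n}"
    (is "?A = ?B \<union> ?C")
  proof (intro equalityI subsetI)
    fix e assume "e \<in> ?A"
    then obtain i j where "e = hedge m i j" "i < m" "j < n" by auto
    then show "e \<in> ?B \<union> ?C" by (cases "i = 0") (auto simp: hedge_def)
  next
    fix e assume "e \<in> ?B \<union> ?C"
    then show "e \<in> ?A"
    proof
      assume "e \<in> ?B"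
      then obtain j where "e = hedge m 0 j" "j < n" by (auto simp: hedge_def)
      moreover have "0 < m" using assms by simp
      ultimately show ?thesis by blast
    next
      assume "e \<in> ?C"
      then obtain i j where "e = Grid {(int i - 1, int j), (int i, int j)}" "0 < i" "i < m" "j < n"
        by auto
      then have "e = hedge m i j" "i < m" "j < n" by (simp_all add: hedge_def)
      then show ?thesis by blast
    qed
  qed
  moreover have "{vedge i j | i j. i < m \<and> Suc j < n} = Grid ` {{(int i, int j), (int i, int j + 1)} | i j. i < m \<and> Suc j < n}"
    by (auto simp: vedge_def)
  ultimately show ?thesis
    by (simp add: cylinder_graph_def grid_edges_eq image_Un Un_ac)
qed

section \<open>Edge sets described column by column\<close>

definition hset :: "nat \<Rightarrow> nat \<Rightarrow> cylinder_edge set \<Rightarrow> nat \<Rightarrow> nat set" where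
  "hset m n M i = {j. j < n \<and> hedge m i j \<in> M}"

definition vset :: "nat \<Rightarrow> cylinder_edge set \<Rightarrow> nat \<Rightarrow> nat set" where
  "vset n M i = {j. Suc j < n \<and> vedge i j \<in> M}"

definition matching_of_rows :: "nat \<Rightarrow> (nat \<Rightarrow> nat set) \<Rightarrow> (nat \<Rightarrow> nat set) \<Rightarrow> cylinder_edge set" where
  "matching_of_rows m H D = {hedge m i j | i j. i < m \<and> j \<in> H i} \<union> {vedge i j | i j. i < m \<and> j \<in> D i}"

lemma hset_wrap: "hset m n M m = hset m n M 0"
  by (simp add: hset_def hedge_def)

lemma hedge_in_matching_of_rows: "i < m \<Longrightarrow> hedge m i j \<in> matching_of_rows m H D \<longleftrightarrow> j \<in> H i"
  using hedge_neq_vedge by (auto simp: matching_of_rows_def hedge_eq_iff)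

lemma vedge_in_matching_of_rows: "i < m \<Longrightarrow> vedge i j \<in> matching_of_rows m H D \<longleftrightarrow> j \<in> D i"
  using hedge_neq_vedge[symmetric] by (auto simp: matching_of_rows_def vedge_eq_iff)

lemma hset_matching_of_rows: "i < m \<Longrightarrow> H i \<subseteq> {..<n} \<Longrightarrow> hset m n (matching_of_rows m H D) i = H i"
  by (auto simp: hset_def hedge_in_matching_of_rows)

lemma vset_matching_of_rows: "i < m \<Longrightarrow> D i \<subseteq> {..<n - 1} \<Longrightarrow> vset n (matching_of_rows m H D) i = D i"
  by (auto simp: vset_def vedge_in_matching_of_rows)

lemma matching_of_rows_subset_edges:
  assumes "m \<ge> 1" "\<And>i. i < m \<Longrightarrow> H i \<subseteq> {..<n}" "\<And>i. i < m \<Longrightarrow> D i \<subseteq> {..<n - 1}"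
  shows "matching_of_rows m H D \<subseteq> edges (cylinder_graph m n)"
proof
  fix e assume "e \<in> matching_of_rows m H D"
  then consider i j where "e = hedge m i j" "i < m" "j \<in> H i" | i j where "e = vedge i j" "i < m" "j \<in> D i"
    by (auto simp: matching_of_rows_def)
  then show "e \<in> edges (cylinder_graph m n)"
  proof cases
    case 1
    then show ?thesis using assms(2)[of i] unfolding edges_cylinder_graph[OF assms(1)] by blast
  next
    case 2
    then have "j < n - 1" using assms(3)[of i] by auto
    then have "Suc j < n" by simp
    then show ?thesis using 2 unfolding edges_cylinder_graph[OF assms(1)] by blast
  qed
qed

lemma matching_of_rows_hset_vset:
  assumes "m \<ge> 1" "M \<subseteq> edges (cylinder_graph m n)"
  shows "matching_of_rows m (hset m n M) (vset n M) = M"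
proof (intro equalityI subsetI)
  fix e assume "e \<in> M"
  then have "e \<in> {hedge m i j | i j. i < m \<and> j < n} \<union> {vedge i j | i j. i < m \<and> Suc j < n}"
    using assms edges_cylinder_graph by blast
  then show "e \<in> matching_of_rows m (hset m n M) (vset n M)"
    using \<open>e \<in> M\<close> by (auto simp: hedge_in_matching_of_rows vedge_in_matching_of_rows hset_def vset_def)
qed (auto simp: matching_of_rows_def hset_def vset_def)

lemma ends_hedge:
  assumes "i < m"
  shows "ends (cylinder_graph m n) (hedge m i j) =
    {(if i = 0 then int m - 1 else int i - 1, int j), (int i, int j)}"
  using assms by (auto simp: cylinder_graph_def hedge_def)

lemma ends_vedge: "ends (cylinder_graph m n) (vedge i j) = {(int i, int j), (int i, int j + 1)}"
  by (simp add: cylinder_graph_def vedge_def)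

lemma hedge_mod: "hedge m (Suc i) j = hedge m (Suc i mod m) j" if "i < m"
  using that by (cases "Suc i = m") (simp_all add: hedge_def)

text \<open>The candidates are the horizontal edges on both sides of column \<open>i\<close> and the
  vertical ones above and below. For \<open>m = 1\<close> the two horizontal ones are the same
  loop.\<close>

lemma incident_edge_iff:
  assumes "e \<in> edges (cylinder_graph m n)" "i < m" "j < n"
  shows "(int i, int j) \<in> ends (cylinder_graph m n) e \<longleftrightarrow>
    e = hedge m i j \<or> e = hedge m (Suc i) j \<or> (Suc j < n \<and> e = vedge i j) \<or> (1 \<le> j \<and> e = vedge i (j - 1))"
proof -
  have m: "m \<ge> 1" using assms by simp
  have i': "Suc i mod m < m" using m by simp
  \<comment> \<open>The left end of the horizontal edge into column \<open>i'\<close> lies in column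
    \<open>i\<close> exactly if \<open>i'\<close> is the cyclic successor of
    \<open>i\<close>.\<close>
  have Suc_mod: "Suc i mod m = i' \<longleftrightarrow> (if i' = 0 then int m - 1 else int i' - 1) = int i" if "i' < m" for i'
    using that assms(2) by (cases "Suc i = m") auto
  consider i' j' where "e = hedge m i' j'" "i' < m" "j' < n" | i' j' where "e = vedge i' j'" "i' < m" "Suc j' < n"
    using assms(1) unfolding edges_cylinder_graph[OF m] by blast
  then show ?thesis
  proof cases
    case 1
    then show ?thesis
      unfolding 1(1) hedge_mod[OF assms(2)] ends_hedge[OF 1(2)]
      using Suc_mod[OF 1(2)] hedge_neq_vedge[of m i' j'] hedge_eq_iff[OF 1(2) assms(2)] hedge_eq_iff[OF 1(2) i']
      by auto
  next
    case 2
    then show ?thesis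
      unfolding 2(1) ends_vedge using assms(3)
      by (auto simp: vedge_eq_iff hedge_neq_vedge[symmetric])
  qed
qed

section \<open>The local matching condition\<close>

definition exactly_one :: "bool \<Rightarrow> bool \<Rightarrow> bool \<Rightarrow> bool \<Rightarrow> bool" where
  "exactly_one a b c d \<longleftrightarrow>
     (a \<or> b \<or> c \<or> d) \<and> \<not> (a \<and> b) \<and> \<not> (a \<and> c) \<and> \<not> (a \<and> d) \<and> \<not> (b \<and> c) \<and> \<not> (b \<and> d) \<and> \<not> (c \<and> d)"

lemma ex1_four_iff:
  assumes "A \<Longrightarrow> B \<Longrightarrow> h \<noteq> h'" "A \<Longrightarrow> C \<Longrightarrow> h \<noteq> v" "A \<Longrightarrow> D \<Longrightarrow> h \<noteq> v'"
    "B \<Longrightarrow> C \<Longrightarrow> h' \<noteq> v" "B \<Longrightarrow> D \<Longrightarrow> h' \<noteq> v'" "C \<Longrightarrow> D \<Longrightarrow> v \<noteq> v'"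
  shows "(\<exists>!e. (A \<and> e = h) \<or> (B \<and> e = h') \<or> (C \<and> e = v) \<or> (D \<and> e = v')) \<longleftrightarrow> exactly_one A B C D"
    (is "(\<exists>!e. ?P e) \<longleftrightarrow> _")
proof
  assume "\<exists>!e. ?P e"
  then obtain e where e: "?P e" and u: "\<And>x. ?P x \<Longrightarrow> x = e" by blast
  have "A \<Longrightarrow> h = e" "B \<Longrightarrow> h' = e" "C \<Longrightarrow> v = e" "D \<Longrightarrow> v' = e" using u by blast+
  then show "exactly_one A B C D" unfolding exactly_one_def using e assms by metis
next
  assume "exactly_one A B C D"
  then consider "A" "\<not> B" "\<not> C" "\<not> D" | "\<not> A" "B" "\<not> C" "\<not> D" | "\<not> A" "\<not> B" "C" "\<not> D" | "\<not> A" "\<not> B" "\<not> C" "D"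
    unfolding exactly_one_def by blast
  then show "\<exists>!e. ?P e" by cases simp_all
qed

text \<open>The first hypothesis tolerates \<open>h = h'\<close>, the loop for \<open>m = 1\<close>,
  as long as it lies outside \<open>M\<close>.\<close>

lemma ex1_incident:
  assumes "h = h' \<Longrightarrow> h \<notin> M" "h \<noteq> v" "h \<noteq> v'" "h' \<noteq> v" "h' \<noteq> v'" "p \<Longrightarrow> q \<Longrightarrow> v \<noteq> v'"
  shows "(\<exists>!e. e \<in> M \<and> (e = h \<or> e = h' \<or> (p \<and> e = v) \<or> (q \<and> e = v'))) \<longleftrightarrow>
    exactly_one (h \<in> M) (h' \<in> M) (p \<and> v \<in> M) (q \<and> v' \<in> M)"
proof -
  have *: "e \<in> M \<and> (e = h \<or> e = h' \<or> (p \<and> e = v) \<or> (q \<and> e = v')) \<longleftrightarrow>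
      (h \<in> M \<and> e = h) \<or> (h' \<in> M \<and> e = h') \<or> ((p \<and> v \<in> M) \<and> e = v) \<or> ((q \<and> v' \<in> M) \<and> e = v')" for e
    by blast
  show ?thesis unfolding * by (rule ex1_four_iff) (use assms in blast)+
qed

text \<open>Each site is covered once: by an incoming edge, by an outgoing edge, or as the lower or
  upper end of a dimer. So the outgoing set is forced.\<close>

lemma exactly_one_iff_next_row:
  assumes "S \<subseteq> {..<n}" "S' \<subseteq> {..<n}" "D \<subseteq> {..<n - 1}"
  shows "(\<forall>j<n. exactly_one (j \<in> S) (j \<in> S') (j \<in> D) (1 \<le> j \<and> j - 1 \<in> D)) \<longleftrightarrow>
    D \<in> dimer_sets (n - 1) S \<and> S' = next_row n S D"
proof -
  have pre: "1 \<le> j \<and> j - 1 \<in> D \<longleftrightarrow> j \<in> Suc ` D" for j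
    by (cases j) auto
  have lt: "j < n" "Suc j < n" if "j \<in> D" for j using that assms(3) by auto
  show ?thesis
    unfolding pre
  proof
    assume L: "\<forall>j<n. exactly_one (j \<in> S) (j \<in> S') (j \<in> D) (j \<in> Suc ` D)"
    have "Suc j \<notin> D" if "j \<in> D" for j
      using L lt(2)[OF that] that by (auto simp: exactly_one_def)
    moreover have "S \<inter> covered D = {}"
      using L assms(1) by (auto simp: exactly_one_def covered_def)
    moreover have "S' = next_row n S D"
      using L assms(2) by (auto simp: exactly_one_def covered_def next_row_def)
    ultimately show "D \<in> dimer_sets (n - 1) S \<and> S' = next_row n S D"
      using assms(3) by (auto simp: dimer_sets_def)
  next
    assume "D \<in> dimer_sets (n - 1) S \<and> S' = next_row n S D"
    then have "\<forall>j\<in>D. Suc j \<notin> D" "S \<inter> covered D = {}" "S' = next_row n S D"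
      by (auto simp: dimer_sets_def)
    then show "\<forall>j<n. exactly_one (j \<in> S) (j \<in> S') (j \<in> D) (j \<in> Suc ` D)"
      by (auto simp: exactly_one_def covered_def next_row_def)
  qed
qed

text \<open>Loops occur only for \<open>m = 1\<close>. There both horizontal slots of a vertex hold
  the same edge, so \<open>exactly_one\<close> excludes it, in agreement with the ban on
  loops.\<close>

lemma perfect_matching_iff:
  assumes "m \<ge> 1" and M: "M \<subseteq> edges (cylinder_graph m n)"
  shows "perfect_matching (cylinder_graph m n) M \<longleftrightarrow>
    (\<forall>i<m. vset n M i \<in> dimer_sets (n - 1) (hset m n M i) \<and>
      hset m n M (Suc i) = next_row n (hset m n M i) (vset n M i))"
proof -
  let ?G = "cylinder_graph m n"
  let ?x = "\<lambda>i j. exactly_one (hedge m i j \<in> M) (hedge m (Suc i) j \<in> M)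
      (Suc j < n \<and> vedge i j \<in> M) (1 \<le> j \<and> vedge i (j - 1) \<in> M)"
  have verts: "(\<forall>v\<in>verts ?G. P v) \<longleftrightarrow> (\<forall>i<m. \<forall>j<n. P (int i, int j))" for P
  proof -
    have int: "{0..int k - 1} = int ` {..<k}" for k
      by (auto simp: image_iff intro!: bexI[of _ "nat _"])
    show ?thesis by (auto simp: cylinder_graph_def grid_verts_def int)
  qed
  have card2: "card (ends ?G (hedge m i j)) = 2 \<longleftrightarrow> m \<noteq> 1" if "i < m" for i j
    using that by (auto simp: ends_hedge card_insert_if)
  have card2': "card (ends ?G (vedge i j)) = 2" for i j
    by (simp add: ends_vedge)
  have loops: "(\<forall>e\<in>M. card (ends ?G e) = 2) \<longleftrightarrow> (m = 1 \<longrightarrow> (\<forall>j<n. hedge m 0 j \<notin> M))"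
  proof
    assume *: "\<forall>e\<in>M. card (ends ?G e) = 2"
    show "m = 1 \<longrightarrow> (\<forall>j<n. hedge m 0 j \<notin> M)"
      using * card2[of 0] by auto
  next
    assume *: "m = 1 \<longrightarrow> (\<forall>j<n. hedge m 0 j \<notin> M)"
    show "\<forall>e\<in>M. card (ends ?G e) = 2"
    proof
      fix e assume "e \<in> M"
      then have "e \<in> {hedge m i j | i j. i < m \<and> j < n} \<union> {vedge i j | i j. i < m \<and> Suc j < n}"
        using M edges_cylinder_graph[OF assms(1)] by blast
      then show "card (ends ?G e) = 2"
        using * \<open>e \<in> M\<close> by (auto simp: card2 card2')
    qed
  qed
  have distinct: "hedge m i j = hedge m (Suc i) j \<Longrightarrow> m = 1 \<and> i = 0" if "i < m" for i j
    using that hedge_eq_iff[of i m "Suc i mod m" j j] unfolding hedge_mod[OF that]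
    by (cases "Suc i = m") auto
  have vertex: "(\<exists>!e. e \<in> M \<and> (int i, int j) \<in> ends ?G e) \<longleftrightarrow> ?x i j"
    if "i < m" "j < n" "m = 1 \<longrightarrow> (\<forall>j<n. hedge m 0 j \<notin> M)" for i j
  proof -
    have "e \<in> M \<and> (int i, int j) \<in> ends ?G e \<longleftrightarrow> e \<in> M \<and>
        (e = hedge m i j \<or> e = hedge m (Suc i) j \<or> (Suc j < n \<and> e = vedge i j) \<or> (1 \<le> j \<and> e = vedge i (j - 1)))" for e
      using incident_edge_iff[of e m n i j] M that by blast
    moreover have "(\<exists>!e. e \<in> M \<and> (e = hedge m i j \<or> e = hedge m (Suc i) j \<or>
        (Suc j < n \<and> e = vedge i j) \<or> (1 \<le> j \<and> e = vedge i (j - 1)))) \<longleftrightarrow> ?x i j"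
    proof (rule ex1_incident)
      show "hedge m i j \<notin> M" if "hedge m i j = hedge m (Suc i) j"
        using distinct[OF \<open>i < m\<close> that] \<open>j < n\<close> \<open>m = 1 \<longrightarrow> _\<close> by simp
      show "vedge i j \<noteq> vedge i (j - 1)" if "1 \<le> j"
        using that by (simp add: vedge_eq_iff)
    qed (rule hedge_neq_vedge)+
    ultimately show ?thesis by simp
  qed
  have loops': "m = 1 \<longrightarrow> (\<forall>j<n. hedge m 0 j \<notin> M)" if "\<forall>i<m. \<forall>j<n. ?x i j"
  proof (intro impI allI)
    fix j assume "m = 1" "j < n"
    then have "?x 0 j" "hedge m (Suc 0) j = hedge m 0 j" using that by (auto simp: hedge_def)
    then show "hedge m 0 j \<notin> M" by (auto simp: exactly_one_def)
  qed
  have "perfect_matching ?G M \<longleftrightarrow> (m = 1 \<longrightarrow> (\<forall>j<n. hedge m 0 j \<notin> M)) \<and>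
      (\<forall>i<m. \<forall>j<n. \<exists>!e. e \<in> M \<and> (int i, int j) \<in> ends ?G e)"
    unfolding perfect_matching_def loops verts using M by (simp only: simp_thms)
  also have "\<dots> \<longleftrightarrow> (\<forall>i<m. \<forall>j<n. ?x i j)"
  proof
    assume *: "(m = 1 \<longrightarrow> (\<forall>j<n. hedge m 0 j \<notin> M)) \<and>
      (\<forall>i<m. \<forall>j<n. \<exists>!e. e \<in> M \<and> (int i, int j) \<in> ends ?G e)"
    show "\<forall>i<m. \<forall>j<n. ?x i j"
    proof (intro allI impI)
      fix i j assume ij: "i < m" "j < n"
      show "?x i j"
        using conjunct2[OF *] ij by (intro iffD1[OF vertex[OF ij conjunct1[OF *]]]) blast
    qed
  next
    assume *: "\<forall>i<m. \<forall>j<n. ?x i j"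
    show "(m = 1 \<longrightarrow> (\<forall>j<n. hedge m 0 j \<notin> M)) \<and>
      (\<forall>i<m. \<forall>j<n. \<exists>!e. e \<in> M \<and> (int i, int j) \<in> ends ?G e)"
    proof (rule conjI[OF loops'[OF *]], intro allI impI)
      fix i j assume ij: "i < m" "j < n"
      show "\<exists>!e. e \<in> M \<and> (int i, int j) \<in> ends ?G e"
        using * ij by (intro iffD2[OF vertex[OF ij loops'[OF *]]]) blast
    qed
  qed
  also have "\<dots> \<longleftrightarrow> (\<forall>i<m. \<forall>j<n. exactly_one (j \<in> hset m n M i) (j \<in> hset m n M (Suc i))
      (j \<in> vset n M i) (1 \<le> j \<and> j - 1 \<in> vset n M i))"
    by (intro all_cong1 imp_cong refl) (auto simp: hset_def vset_def exactly_one_def)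
  also have "\<dots> \<longleftrightarrow> (\<forall>i<m. vset n M i \<in> dimer_sets (n - 1) (hset m n M i) \<and>
      hset m n M (Suc i) = next_row n (hset m n M i) (vset n M i))"
    by (intro all_cong1 imp_cong refl exactly_one_iff_next_row) (auto simp: hset_def vset_def)
  finally show ?thesis .
qed

text \<open>The edges entering column 0 and the dimers of all columns determine a matching; the
  edges entering the other columns are recovered as ends of initial segments of the walk.\<close>

lemma card_closed_walks:
  assumes "m \<ge> 1"
  shows "card (closed_walks n m) = num_perfect_matchings (cylinder_graph m n)"
proof -
  let ?G = "cylinder_graph m n"
  let ?f = "\<lambda>M. (hset m n M 0, map (vset n M) [0..<m])"
  let ?H = "\<lambda>(S, Ds) i. walk_end n S (take i Ds)" and ?D = "\<lambda>(S, Ds) i. Ds ! i"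
  let ?g = "\<lambda>w. matching_of_rows m (?H w) (?D w)"
  have f: "?f M \<in> closed_walks n m \<and> ?g (?f M) = M" if "perfect_matching ?G M" for M
  proof -
    have M: "M \<subseteq> edges ?G" using that by (simp add: perfect_matching_def)
    have step: "vset n M i \<in> dimer_sets (n - 1) (hset m n M i) \<and>
        hset m n M (Suc i) = next_row n (hset m n M i) (vset n M i)" if "i < m" for i
      using that \<open>perfect_matching ?G M\<close> perfect_matching_iff[OF assms M] by blast
    have walk: "valid_walk n (hset m n M 0) (map (vset n M) [0..<k]) \<and>
        walk_end n (hset m n M 0) (map (vset n M) [0..<k]) = hset m n M k" if "k \<le> m" for k
      using that step by (intro valid_walk_map) simp
    have "?f M \<in> closed_walks n m"
      using walk[of m] by (auto simp: closed_walks_def walks_def hset_wrap hset_def)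
    moreover have "?g (?f M) = matching_of_rows m (hset m n M) (vset n M)"
      using walk by (auto simp: matching_of_rows_def take_map)
    ultimately show ?thesis using matching_of_rows_hset_vset[OF assms M] by simp
  qed
  have g: "perfect_matching ?G (?g w) \<and> ?f (?g w) = w" if w: "w \<in> closed_walks n m" for w
  proof -
    obtain S Ds where SD: "w = (S, Ds)" "S \<subseteq> {..<n}" "length Ds = m" "valid_walk n S Ds" "walk_end n S Ds = S"
      using w by (auto simp: closed_walks_def walks_def)
    define H where "H i = walk_end n S (take i Ds)" for i
    define D where "D i = Ds ! i" for i
    have H: "H i \<subseteq> {..<n}" for i unfolding H_def by (rule walk_end_subset[OF SD(2)])
    have step: "D i \<in> dimer_sets (n - 1) (H i)" "H (Suc i) = next_row n (H i) (D i)" if "i < m" for i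
      using valid_walk_nth[OF SD(4), of i] that SD(3) by (auto simp: H_def D_def)
    have D: "D i \<subseteq> {..<n - 1}" if "i < m" for i using step(1)[OF that] by (simp add: dimer_sets_def)
    have Hm: "H m = H 0" using SD(3,5) by (simp add: H_def)
    have gw: "?g w = matching_of_rows m H D" by (simp add: SD(1) H_def[abs_def] D_def[abs_def])
    have sub: "matching_of_rows m H D \<subseteq> edges ?G" using H D by (intro matching_of_rows_subset_edges[OF assms])
    have hs: "hset m n (matching_of_rows m H D) i = H i" if "i \<le> m" for i
    \<comment> \<open>At \<open>i = m\<close> the set of edges is that of column 0 again, and the
      walk is closed.\<close>
    proof (cases "i = m")
      case True
      then show ?thesis using hset_wrap[of m n "matching_of_rows m H D"] hset_matching_of_rows[of 0 m H n D] H assms Hm by simp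
    next
      case False
      then show ?thesis using that H by (intro hset_matching_of_rows) auto
    qed
    have vs: "vset n (matching_of_rows m H D) i = D i" if "i < m" for i
      using that D by (intro vset_matching_of_rows) auto
    have "perfect_matching ?G (matching_of_rows m H D)"
      unfolding perfect_matching_iff[OF assms sub] using hs vs step by simp
    moreover have "map (vset n (matching_of_rows m H D)) [0..<m] = Ds"
      using SD(3) vs by (intro nth_equalityI) (auto simp: D_def)
    ultimately show ?thesis unfolding gw using hs[of 0] SD(1) by (simp add: H_def)
  qed
  have "bij_betw ?f {M. perfect_matching ?G M} (closed_walks n m)"
    by (rule bij_betw_byWitness[where f' = ?g]) (use f g in blast)+
  then show ?thesis
    unfolding num_perfect_matchings_def by (rule bij_betw_same_card[symmetric])
qed

section \<open>The product formula\<close>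

lemma prod_mirror:
  fixes g :: "nat \<Rightarrow> 'a::comm_monoid_mult"
  shows "(\<Prod>k=1..n. g (n + 1 - k)) = (\<Prod>k=1..n. g k)"
  by (rule prod.reindex_bij_witness[of _ "\<lambda>k. n + 1 - k" "\<lambda>k. n + 1 - k"]) auto

theorem theorem7p1:
  fixes m n :: nat
  assumes "m \<ge> 1"
  shows "real (num_perfect_matchings (cylinder_graph m n)) =
    root 4 (\<Prod>k=1..n.
        (1 + (cos (real k * pi / (real n + 1)) + sqrt (1 + (cos (real k * pi / (real n + 1)))\<^sup>2)) ^ m) *
        (1 + (cos (real k * pi / (real n + 1)) - sqrt (1 + (cos (real k * pi / (real n + 1)))\<^sup>2)) ^ m)) *
    root 4 (\<Prod>k=1..n.
        (1 + (- cos (real k * pi / (real n + 1)) + sqrt (1 + (cos (real k * pi / (real n + 1)))\<^sup>2)) ^ m) *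
        (1 + (- cos (real k * pi / (real n + 1)) - sqrt (1 + (cos (real k * pi / (real n + 1)))\<^sup>2)) ^ m))"
    (is "_ = root 4 ?F * root 4 ?G")
proof -
  define M where "M = real (num_perfect_matchings (cylinder_graph m n))"
  define a where "a k = mode_ev n k" for k
  \<comment> \<open>Both radicands equal this product: the conjugate root is
    \<open>- inverse (a k)\<close>, and mirroring \<open>k\<close> carries the second product into
    the first.\<close>
  define F where "F = (\<Prod>k=1..n. (1 + a k ^ m) * (1 + (- inverse (a k)) ^ m))"
  have M: "M = fock_trace n (transfer n ^^ m)"
    unfolding M_def fock_trace_transfer_pow card_closed_walks[OF assms] ..
  have a_pos: "a k > 0" for k by (simp add: a_def mode_ev_pos)
  have a_mirror: "a (n + 1 - k) = inverse (a k)" if "k \<le> n" for k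
    using that unfolding a_def by (rule mode_ev_mirror)
  have conj: "sqrt (1 + (mode_cos n k)\<^sup>2) - mode_cos n k = inverse (a k)" for k
    unfolding a_def by (rule inverse_unique[OF mode_ev_mult_conj, symmetric])
  have FF: "?F = F"
    unfolding F_def mode_cos_def[symmetric] conj[symmetric] by (simp add: a_def mode_ev_def)
  have "?G = (\<Prod>k=1..n. (1 + inverse (a k) ^ m) * (1 + (- a k) ^ m))"
    unfolding mode_cos_def[symmetric] conj[symmetric] by (simp add: a_def mode_ev_def)
  also have "\<dots> = (\<Prod>k=1..n. (1 + a (n + 1 - k) ^ m) * (1 + (- inverse (a (n + 1 - k))) ^ m))"
    by (intro prod.cong refl) (simp add: a_mirror[simplified])
  also have "\<dots> = F"
    unfolding F_def by (rule prod_mirror)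
  finally have GF: "?G = F" .
  \<comment> \<open>The absolute value is needed since \<open>F\<close> can be negative for odd
    \<open>m\<close>.\<close>
  have "\<bar>F\<bar> = M ^ 2"
  proof (cases "even m")
    case True
    have "(\<Prod>k=1..n. 1 + inverse (a k) ^ m) = (\<Prod>k=1..n. 1 + a (n + 1 - k) ^ m)"
      by (intro prod.cong refl) (simp add: a_mirror[simplified])
    also have "\<dots> = (\<Prod>k=1..n. 1 + a k ^ m)"
      by (rule prod_mirror)
    finally have "F = (\<Prod>k=1..n. 1 + a k ^ m) ^ 2"
      using True by (simp add: F_def prod.distrib power2_eq_square)
    then show ?thesis
      using fock_trace_transfer_even[OF True, of n] by (simp add: M a_def)
  next
    case odd: False
    \<comment> \<open>For odd \<open>m\<close> the two factors multiply to (1 + a^m) (1 - a^(-m)) =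
      a^m - a^(-m).\<close>
    define x where "x k = a k ^ m - inverse (a k) ^ m" for k
    have x_mirror: "x (n + 1 - k) = - x k" if "k \<le> n" for k
      using a_mirror[OF that] by (simp add: x_def)
    have "(1 + a k ^ m) * (1 + (- inverse (a k)) ^ m) = x k" for k
    proof -
      have "a k ^ m * inverse (a k) ^ m = 1"
        using a_pos[of k] by (simp flip: power_mult_distrib)
      then show ?thesis using odd by (simp add: x_def algebra_simps)
    qed
    then have Fx: "F = (\<Prod>k=1..n. x k)"
      by (simp add: F_def)
    show ?thesis
    proof (cases "even n")
      case True
      then obtain r where r: "n = 2 * r" by blast
      \<comment> \<open>Mirrored indices contribute \<open>- x k\<close>, so up to sign both halves
        are the product in \<open>fock_trace_transfer_odd_even\<close>.\<close>
      have "(\<Prod>k=1..n. x k) = (\<Prod>k\<in>{1..r}. x k) * (\<Prod>k\<in>{r+1..n}. x k)"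
        using r by (subst prod.union_disjoint[symmetric]) (auto intro!: prod.cong)
      also have "(\<Prod>k\<in>{r+1..n}. x k) = (\<Prod>k\<in>{1..r}. x (n + 1 - k))"
        by (rule prod.reindex_bij_witness[of _ "\<lambda>k. n + 1 - k" "\<lambda>k. n + 1 - k"]) (auto simp: r)
      also have "\<dots> = (\<Prod>k\<in>{1..r}. - x k)"
        using r by (intro prod.cong refl x_mirror) auto
      finally have "\<bar>F\<bar> = \<bar>\<Prod>k\<in>{1..r}. x k\<bar> ^ 2"
        unfolding Fx by (simp add: abs_mult abs_prod power2_eq_square)
      moreover have "\<bar>M\<bar> = \<bar>\<Prod>k\<in>{1..r}. x k\<bar>"
        unfolding M x_def a_def using odd r by (intro fock_trace_transfer_odd_even)
      ultimately show ?thesis by (simp add: M_def)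
    next
      case False
      \<comment> \<open>The middle index is its own mirror image, so \<open>x\<close> vanishes
        there.\<close>
      define k where "k = (n + 1) div 2"
      have "k \<in> {1..n}" "n + 1 - k = k" using False by (auto simp: k_def elim!: oddE)
      then have "x k = 0" using x_mirror[of k] by simp
      then have "F = 0" using \<open>k \<in> {1..n}\<close> unfolding Fx by (auto intro!: prod_zero)
      then show ?thesis
        using fock_trace_transfer_odd_odd[OF odd False] by (simp add: M)
    qed
  qed
  \<comment> \<open>Squaring removes the sign of \<open>F\<close>; \<open>root 4\<close> is
    multiplicative on negative numbers too.\<close>
  then have "F * F = M ^ 4"
    by (metis abs_mult_self_eq power2_eq_square power_add numeral_Bit0)
  moreover have "M \<ge> 0" by (simp add: M_def)
  ultimately have "root 4 F * root 4 F = M"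
    by (simp add: real_root_mult[symmetric] real_root_power_cancel)
  then show ?thesis unfolding FF GF M_def ..
qed

end
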